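(* Let $H=F+G$. In the compact two-stage two-derivative IMEX method for $U_t=F(U)+G(U)$, replace the full derivatives $\dot F=F_U(F+G)$, $\dot G=G_U(F+G)$ by the incomplete self derivatives $$\widetilde{\dot F}=F_UF,\qquad \widetilde{\dot G}=G_UG.$$ Then one numerical step, i.e. $$U^*=U^n+\tfrac h2F(U^n)+\tfrac{h^2}{8}\widetilde{\dot F}(U^n)+\tfrac h2G(U^* )-\tfrac{h^2}{8}\widetilde{\dot G}(U^* ),$$ $$\widetilde U^{n+1}=U^n+hF(U^n)+\tfrac{h^2}{6}\big[\widetilde{\dot F}(U^n)+2\widetilde{\dot F}(U^* )\big]+hG(\widetilde U^{n+1})-\tfrac{h^2}{6}\big[\widetilde{\dot G}(\widetilde U^{n+1})+2\widetilde{\dot G}(U^* )\big],$$ satisfies $$\widetilde U^{n+1}=U^n+hH+\frac{h^2}{2}H_UH+\frac{h^2}{2}(G_UF-F_UG)+O(h^3).$$ For $F(U)=AU$, $G(U)=BU$, $$\widetilde U^{n+1}-U(t_n+h)=-\frac{h^2}{2}[A,B]U^n+O(h^3),\qquad [A,B]=AB-BA.$$ Thus a nonzero commutator generically produces first-order global accuracy under stability.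
   Context: $h=\Delta t$ is the time step; $U(t)$ is the exact solution of $U_t=H(U)$ with $U(t_n)=U^n$. $F_U,G_U,H_U$ denote Jacobians, and $F_UF$ is the map $U\mapsto F_U(U)F(U)$ (similarly for the other products). In the expansion, fields and Jacobians without displayed argument are evaluated at $U^n$. In the linear case $A,B$ are linear operators (matrices). "Stability" refers to one-step stability of the numerical map. *)

theory Defs
  imports "HOL-Analysis.Analysis" "HOL-Library.Landau_Symbols"
begin

definition cont_diff_on ::
    "('a::real_normed_vector \<Rightarrow> 'b::real_normed_vector) \<Rightarrow> 'a set \<Rightarrow> bool" where
  "cont_diff_on f S \<longleftrightarrow>
     (\<exists>f' :: 'a \<Rightarrow> 'a \<Rightarrow>\<^sub>L 'b.
        (\<forall>x\<in>S. (f has_derivative blinfun_apply (f' x)) (at x)) \<and> continuous_on S f')"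

text \<open>Class C2: a continuously differentiable field whose Jacobian is again continuously
  differentiable.  Only meaningful for open \<open>S\<close>.\<close>

definition C2_on :: "(real^'n \<Rightarrow> real^'n) \<Rightarrow> (real^'n) set \<Rightarrow> bool" where
  "C2_on F S \<longleftrightarrow> cont_diff_on F S \<and> cont_diff_on (\<lambda>u. jacobian F (at u)) S"

definition self_derivative :: "(real^'n \<Rightarrow> real^'n) \<Rightarrow> real^'n \<Rightarrow> real^'n" where
  "self_derivative F u = jacobian F (at u) *v F u"

text \<open>The method is implicit, so a step is a relation between the old value \<open>u\<close>, the
  stage value \<open>us\<close> and the new value \<open>un\<close>.\<close>

definition imex_step ::
    "(real^'n \<Rightarrow> real^'n) \<Rightarrow> (real^'n \<Rightarrow> real^'n) \<Rightarrow> real \<Rightarrow>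
     real^'n \<Rightarrow> real^'n \<Rightarrow> real^'n \<Rightarrow> bool" where
  "imex_step F G h u us un \<longleftrightarrow>
     us = u + (h / 2) *\<^sub>R F u + (h\<^sup>2 / 8) *\<^sub>R self_derivative F u
            + (h / 2) *\<^sub>R G us - (h\<^sup>2 / 8) *\<^sub>R self_derivative G us \<and>
     un = u + h *\<^sub>R F u
            + (h\<^sup>2 / 6) *\<^sub>R (self_derivative F u + 2 *\<^sub>R self_derivative F us)
            + h *\<^sub>R G un
            - (h\<^sup>2 / 6) *\<^sub>R (self_derivative G un + 2 *\<^sub>R self_derivative G us)"

definition exact_solution ::
    "(real^'n \<Rightarrow> real^'n) \<Rightarrow> real set \<Rightarrow> (real \<Rightarrow> real^'n) \<Rightarrow> bool" where
  "exact_solution H I U \<longleftrightarrow>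
     (\<forall>t\<in>I. (U has_vector_derivative H (U t)) (at t within I))"

definition exact_flow ::
    "(real^'n \<Rightarrow> real^'n) \<Rightarrow> (real \<Rightarrow> real^'n \<Rightarrow> real^'n) \<Rightarrow> bool" where
  "exact_flow H E \<longleftrightarrow> (\<forall>u. E 0 u = u \<and> exact_solution H {0..} (\<lambda>t. E t u))"

text \<open>\<open>\<Phi> h\<close> is the numerical map with time step \<open>h\<close>, required to be given by the method
  for all sufficiently small positive \<open>h\<close> only.\<close>

definition numerical_map ::
    "(real^'n \<Rightarrow> real^'n) \<Rightarrow> (real^'n \<Rightarrow> real^'n) \<Rightarrow> (real \<Rightarrow> real^'n \<Rightarrow> real^'n) \<Rightarrow> bool" where
  "numerical_map F G \<Phi> \<longleftrightarrow>
     (\<forall>\<^sub>F h in at_right 0. \<forall>u. \<exists>us. imex_step F G h u us (\<Phi> h u))"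

definition one_step_stable :: "(real \<Rightarrow> real^'n \<Rightarrow> real^'n) \<Rightarrow> bool" where
  "one_step_stable \<Phi> \<longleftrightarrow>
     (\<exists>L\<ge>0. \<forall>\<^sub>F h in at_right 0. \<forall>u v. norm (\<Phi> h u - \<Phi> h v) \<le> (1 + L * h) * norm (u - v))"

definition global_error ::
    "(real \<Rightarrow> real^'n \<Rightarrow> real^'n) \<Rightarrow> (real \<Rightarrow> real^'n \<Rightarrow> real^'n) \<Rightarrow>
     real \<Rightarrow> nat \<Rightarrow> real^'n \<Rightarrow> real" where
  "global_error E \<Phi> h k u = norm ((\<Phi> h ^^ k) u - E (real k * h) u)"

definition commutator :: "real^'n^'n \<Rightarrow> real^'n^'n \<Rightarrow> real^'n^'n" where
  "commutator A B = A ** B - B ** A"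

end

theory Submission
  imports Defs "HOL-Complex_Analysis.Conformal_Mappings"
begin

text \<open>
  The local expansion follows by inserting \<open>U* = u + O(h)\<close> and \<open>Unew = u + h H(u) + O(h^2)\<close> into the
  implicit equation for the new value.  In the linear case the step is
  \<open>v \<mapsto> v + h M v + (h^2/2) (M^2 - C) v\<close> up to \<open>O(h^3 |v|)\<close>, where \<open>M = A + B\<close> and \<open>C = [A,B]\<close>.

  For the global error let \<open>y = E(t)u\<close> and let \<open>w\<close> solve \<open>w' = M w + C y\<close>, \<open>w(0) = 0\<close>.  The corrected
  trajectory \<open>y - (h/2) w\<close> satisfies the numerical recursion up to \<open>O(h^3)\<close>, so by stability the
  global error is \<open>-(h/2) w + O(h^2)\<close>.  It is exactly of first order wherever \<open>w(T) \<noteq> 0\<close>.  Since \<open>w\<close>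
  is analytic in \<open>T\<close> with \<open>w'(0) = C u\<close>, for \<open>C u \<noteq> 0\<close> it has only countably many zeros, and by
  Fubini the pairs \<open>(T, u)\<close> with \<open>w(T) = 0\<close> form a null set.
\<close>

subsection \<open>Local expansion for nonlinear fields\<close>

lemma bounded_bilinear_matrix_vector_mult:
  "bounded_bilinear ((*v) :: real^'n^'m \<Rightarrow> real^'n \<Rightarrow> real^'m)"
proof -
  have "bilinear ((*v) :: real^'n^'m \<Rightarrow> real^'n \<Rightarrow> real^'m)"
    unfolding bilinear_def
    by (auto intro!: linearI simp: matrix_vector_mult_add_rdistrib matrix_vector_right_distrib
        scaleR_matrix_vector_assoc matrix_vector_mult_scaleR)
  then show ?thesis by (simp add: bilinear_conv_bounded_bilinear)
qed

lemma C2_on_imp_differentiable: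
  assumes "C2_on F S" "x \<in> S"
  shows "F differentiable (at x)" "(\<lambda>u. jacobian F (at u)) differentiable (at x)"
  using assms unfolding C2_on_def cont_diff_on_def by (blast intro: differentiableI)+

text \<open>The product rule for the bilinear matrix-vector product, applied to the Jacobian and the
  field. It makes the increments of the self derivatives along a step O(h).\<close>

lemma C2_on_imp_self_derivative_differentiable:
  assumes "C2_on F S" "x \<in> S"
  shows "self_derivative F differentiable (at x)"
proof -
  interpret bounded_bilinear "(*v) :: real^'n^'n \<Rightarrow> real^'n \<Rightarrow> real^'n"
    by (rule bounded_bilinear_matrix_vector_mult)
  obtain F' J' where "(F has_derivative F') (at x)"
      and "((\<lambda>u. jacobian F (at u)) has_derivative J') (at x)"
    using C2_on_imp_differentiable[OF assms] by (auto simp: differentiable_def)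
  from FDERIV[OF this(2,1)] show ?thesis
    unfolding self_derivative_def[abs_def] by (rule differentiableI)
qed

text \<open>The definition of the derivative with tolerance 1 leaves the linear part plus at most
  \<open>norm (y - u)\<close>. Only increments from the fixed centre \<open>u\<close> are
  compared.\<close>

lemma differentiable_imp_locally_Lipschitz_at:
  fixes f :: "'a::real_normed_vector \<Rightarrow> 'b::real_normed_vector"
  assumes "f differentiable (at u)"
  obtains C where "C \<ge> 0" "\<forall>\<^sub>F x in nhds u. norm (f x - f u) \<le> C * norm (x - u)"
proof -
  obtain f' where f': "(f has_derivative f') (at u)" using assms by (auto simp: differentiable_def)
  obtain d where d: "d > 0"
      "\<And>y. norm (y - u) < d \<Longrightarrow> norm (f y - f u - f' (y - u)) \<le> 1 * norm (y - u)"
    using f' unfolding has_derivative_at_alt by (meson zero_less_one)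
  obtain K where K: "K \<ge> 0" "\<And>x. norm (f' x) \<le> norm x * K"
    using bounded_linear.nonneg_bounded[OF has_derivative_bounded_linear[OF f']] by blast
  have "norm (f y - f u) \<le> (1 + K) * norm (y - u)" if "norm (y - u) < d" for y
  proof -
    have "norm (f y - f u) \<le> norm (f y - f u - f' (y - u)) + norm (f' (y - u))"
      by (metis diff_add_cancel norm_triangle_ineq)
    with d(2)[OF that] K(2)[of "y - u"] show ?thesis by (simp add: algebra_simps)
  qed
  then have "\<forall>\<^sub>F x in nhds u. norm (f x - f u) \<le> (1 + K) * norm (x - u)"
    unfolding eventually_nhds_metric dist_norm using d(1) by blast
  then show thesis using K(1) by (intro that[of "1 + K"]) auto
qed

text \<open>Mean value inequality for \<open>G y - J(u) y\<close> on the closed ball around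
  \<open>u\<close> through \<open>x\<close>: its derivative there is the increment of the Jacobian,
  which is O(\<open>norm (x - u)\<close>).\<close>

lemma taylor_bound_second_order:
  fixes G :: "real^'n \<Rightarrow> real^'n"
  assumes "\<forall>\<^sub>F x in nhds u. G differentiable (at x)"
    and "(\<lambda>x. jacobian G (at x)) differentiable (at u)"
  obtains C where "\<forall>\<^sub>F x in nhds u.
    norm (G x - G u - jacobian G (at u) *v (x - u)) \<le> C * norm (x - u) ^ 2"
proof -
  interpret mv: bounded_bilinear "(*v) :: real^'n^'n \<Rightarrow> real^'n \<Rightarrow> real^'n"
    by (rule bounded_bilinear_matrix_vector_mult)
  let ?J = "\<lambda>x. jacobian G (at x)"
  obtain K where K: "K > 0" "\<And>A x. norm (A *v x :: real^'n) \<le> norm (A :: real^'n^'n) * norm x * K"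
    using mv.pos_bounded by blast
  obtain C where C: "C \<ge> 0" "\<forall>\<^sub>F x in nhds u. norm (?J x - ?J u) \<le> C * norm (x - u)"
    using differentiable_imp_locally_Lipschitz_at[OF assms(2)] by blast
  obtain d where d: "d > 0"
    "\<And>x. dist x u < d \<Longrightarrow> G differentiable (at x) \<and> norm (?J x - ?J u) \<le> C * norm (x - u)"
    using eventually_conj[OF assms(1) C(2)] unfolding eventually_nhds_metric by blast
  have "norm (G x - G u - ?J u *v (x - u)) \<le> (C * K) * norm (x - u) ^ 2" if x: "dist x u < d" for x
  proof -
    let ?r = "norm (x - u)" and ?\<phi> = "\<lambda>y. G y - ?J u *v y"
    have "norm (?\<phi> x - ?\<phi> u) \<le> (C * ?r * K) * norm (x - u)"
    proof (rule differentiable_bound[of "cball u ?r" _ "\<lambda>y v. (?J y - ?J u) *v v"])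
      fix y assume y: "y \<in> cball u ?r"
      then have yd: "dist y u < d" and yr: "norm (y - u) \<le> ?r"
        using x by (auto simp: dist_norm norm_minus_commute)
      have "(?\<phi> has_derivative (\<lambda>v. ?J y *v v - ?J u *v v)) (at y)"
        using d(2)[OF yd] unfolding jacobian_works
        by (intro derivative_intros bounded_linear_imp_has_derivative) auto
      then show "(?\<phi> has_derivative (\<lambda>v. (?J y - ?J u) *v v)) (at y within cball u ?r)"
        by (simp add: matrix_vector_mult_diff_rdistrib has_derivative_at_withinI)
      have "norm (?J y - ?J u) \<le> C * ?r"
        using d(2)[OF yd] yr C(1) by (meson mult_left_mono order_trans)
      have "norm ((?J y - ?J u) *v v) \<le> (C * ?r * K) * norm v" for v
      proof -
        have "norm ((?J y - ?J u) *v v) \<le> norm (?J y - ?J u) * norm v * K" by (rule K(2))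
        also have "\<dots> \<le> (C * ?r) * norm v * K"
          using K(1) \<open>norm (?J y - ?J u) \<le> C * ?r\<close> by (intro mult_right_mono) auto
        finally show ?thesis by (simp add: mult_ac)
      qed
      then show "onorm ((*v) (?J y - ?J u)) \<le> C * ?r * K" by (rule onorm_le)
    qed (auto simp: dist_norm norm_minus_commute)
    then show ?thesis
      by (simp add: algebra_simps power2_eq_square matrix_vector_mult_diff_distrib)
  qed
  then show thesis
    by (intro that[of "C * K"]) (use d(1) in \<open>auto simp: eventually_nhds_metric\<close>)
qed

section \<open>Calculus of vector-valued remainders of order h^k as h tends to 0 from the
  right\<close>

definition order_at_0 :: "nat \<Rightarrow> (real \<Rightarrow> 'a::real_normed_vector) \<Rightarrow> bool" where
  "order_at_0 k r \<longleftrightarrow> (\<exists>C. \<forall>\<^sub>F h in at_right 0. norm (r h) \<le> C * h ^ k)"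

lemma order_at_0I:
  "\<forall>\<^sub>F h in at_right 0. norm (r h) \<le> C * h ^ k \<Longrightarrow> order_at_0 k r"
  unfolding order_at_0_def by blast

text \<open>Passage to the Landau symbol is postponed to the very end; before that, vector
  remainders are added and mapped directly, without taking norms.\<close>

lemma order_at_0_imp_bigo:
  assumes "order_at_0 k r"
  shows "(\<lambda>h. norm (r h)) \<in> O[at_right 0](\<lambda>h. h ^ k)"
proof -
  obtain C where "\<forall>\<^sub>F h in at_right 0. norm (r h) \<le> C * h ^ k"
    using assms unfolding order_at_0_def by blast
  then have "\<forall>\<^sub>F h in at_right 0. norm (norm (r h)) \<le> C * norm (h ^ k)"
    using eventually_at_right_less[of 0] by eventually_elim auto
  then show ?thesis by (rule bigoI)
qed

lemma order_at_0_add: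
  assumes "order_at_0 k r" "order_at_0 k s"
  shows "order_at_0 k (\<lambda>h. r h + s h)"
proof -
  obtain C D where "\<forall>\<^sub>F h in at_right 0. norm (r h) \<le> C * h ^ k"
      "\<forall>\<^sub>F h in at_right 0. norm (s h) \<le> D * h ^ k"
    using assms unfolding order_at_0_def by blast
  then have "\<forall>\<^sub>F h in at_right 0. norm (r h + s h) \<le> (C + D) * h ^ k"
    by eventually_elim (auto simp: algebra_simps intro: norm_triangle_mono)
  then show ?thesis by (rule order_at_0I)
qed

lemma order_at_0_bounded_linear:
  assumes "bounded_linear f" "order_at_0 k r"
  shows "order_at_0 k (\<lambda>h. f (r h))"
proof -
  obtain K where K: "K \<ge> 0" "\<And>x. norm (f x) \<le> norm x * K"
    using bounded_linear.nonneg_bounded[OF assms(1)] by blast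
  obtain C where "\<forall>\<^sub>F h in at_right 0. norm (r h) \<le> C * h ^ k"
    using assms unfolding order_at_0_def by blast
  then have "\<forall>\<^sub>F h in at_right 0. norm (f (r h)) \<le> (C * K) * h ^ k"
  proof eventually_elim
    case (elim h)
    then show ?case using K order_trans[OF K(2) mult_right_mono[OF elim K(1)]] by (simp add: mult_ac)
  qed
  then show ?thesis by (rule order_at_0I)
qed

text \<open>A prefactor h^j raises the order by j. A smaller target order \<open>m\<close> is also
  allowed, since powers decrease for h < 1, so that terms of different orders can be added.\<close>

lemma order_at_0_scaleR_power:
  assumes "order_at_0 k r" "m \<le> j + k"
  shows "order_at_0 m (\<lambda>h. h ^ j *\<^sub>R r h)"
proof -
  obtain C where "\<forall>\<^sub>F h in at_right 0. norm (r h) \<le> C * h ^ k"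
    using assms unfolding order_at_0_def by blast
  then have "\<forall>\<^sub>F h in at_right 0. norm (h ^ j *\<^sub>R r h) \<le> \<bar>C\<bar> * h ^ m"
    using eventually_at_right_real[of 0 1, simplified]
  proof eventually_elim
    case (elim h)
    then have h: "0 < h" "h < 1" by auto
    have "norm (h ^ j *\<^sub>R r h) = h ^ j * norm (r h)" using h by simp
    also have "\<dots> \<le> h ^ j * (\<bar>C\<bar> * h ^ k)"
      using elim h by (intro mult_left_mono order_trans[OF elim(1)] mult_right_mono) auto
    also have "\<dots> = \<bar>C\<bar> * h ^ (j + k)" by (simp add: power_add)
    also have "\<dots> \<le> \<bar>C\<bar> * h ^ m"
      using h assms(2) by (intro mult_left_mono power_decreasing) auto
    finally show ?case .
  qed
  then show ?thesis by (rule order_at_0I)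
qed

lemmas order_at_0_scaleR = order_at_0_bounded_linear[OF bounded_linear_scaleR_right]

lemma order_at_0_diff:
  assumes "order_at_0 k r" "order_at_0 k s"
  shows "order_at_0 k (\<lambda>h. r h - s h)"
  using order_at_0_add[OF assms(1) order_at_0_scaleR[OF assms(2), of "-1"]] by simp

lemma order_at_0_cong:
  assumes "\<forall>\<^sub>F h in at_right 0. r h = s h" "order_at_0 k s"
  shows "order_at_0 k r"
proof -
  obtain C where "\<forall>\<^sub>F h in at_right 0. norm (s h) \<le> C * h ^ k"
    using assms unfolding order_at_0_def by blast
  with assms(1) have "\<forall>\<^sub>F h in at_right 0. norm (r h) \<le> C * h ^ k"
    by eventually_elim auto
  then show ?thesis by (rule order_at_0I)
qed

lemma order_at_0_const: "order_at_0 0 (\<lambda>_. c)"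
  by (rule order_at_0I[where C = "norm c"]) simp

text \<open>Starting point of the bootstrap: of the implicitly defined values one knows a priori
  only that they stay in a compact set.\<close>

lemma order_at_0_compact:
  assumes "compact K" "continuous_on K f" "\<forall>\<^sub>F h in at_right 0. x h \<in> K"
  shows "order_at_0 0 (\<lambda>h. f (x h))"
proof -
  have "bounded (f ` K)" using assms by (intro compact_imp_bounded compact_continuous_image)
  then obtain B where "\<And>y. y \<in> K \<Longrightarrow> norm (f y) \<le> B" unfolding bounded_iff by blast
  then show ?thesis
    by (intro order_at_0I[where C = B] eventually_mono[OF assms(3)]) auto
qed

lemma order_at_0_imp_tendsto:
  assumes "order_at_0 1 (\<lambda>h. x h - u)"
  shows "filterlim x (nhds u) (at_right 0)"
proof -
  obtain C where "\<forall>\<^sub>F h in at_right 0. norm (x h - u) \<le> C * h ^ 1"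
    using assms unfolding order_at_0_def by blast
  moreover have "((\<lambda>h. C * h ^ 1) \<longlongrightarrow> C * 0 ^ 1) (at_right 0)"
    by (intro tendsto_intros)
  then have "((\<lambda>h. C * h ^ 1) \<longlongrightarrow> 0) (at_right 0)" by simp
  ultimately have "((\<lambda>h. x h - u) \<longlongrightarrow> 0) (at_right 0)"
    by (rule Lim_null_comparison)
  then show ?thesis by (rule iffD2[OF Lim_null])
qed

text \<open>Transports a local estimate at \<open>u\<close> along a curve \<open>x h\<close> =
  \<open>u\<close> + O(h): the curve converges to \<open>u\<close>, so the estimate holds
  eventually. The sign of \<open>C\<close> is unknown, hence the absolute value.\<close>

lemma order_at_0_compose:
  assumes x: "order_at_0 1 (\<lambda>h. x h - u)"
    and f: "\<forall>\<^sub>F y in nhds u. norm (f y) \<le> C * norm (y - u) ^ j" 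
  shows "order_at_0 j (\<lambda>h. f (x h))"
proof -
  obtain D where "\<forall>\<^sub>F h in at_right 0. norm (x h - u) \<le> D * h ^ 1"
    using x unfolding order_at_0_def by blast
  moreover have "\<forall>\<^sub>F h in at_right 0. norm (f (x h)) \<le> C * norm (x h - u) ^ j"
    by (rule eventually_compose_filterlim[OF f order_at_0_imp_tendsto[OF x]])
  ultimately have "\<forall>\<^sub>F h in at_right 0. norm (f (x h)) \<le> (\<bar>C\<bar> * D ^ j) * h ^ j"
  proof eventually_elim
    case (elim h)
    have "norm (f (x h)) \<le> \<bar>C\<bar> * norm (x h - u) ^ j"
      using elim(2) by (rule order_trans) (simp add: mult_right_mono)
    also have "\<dots> \<le> \<bar>C\<bar> * (D * h ^ 1) ^ j"
      using elim(1) by (intro mult_left_mono power_mono) auto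
    finally show ?case by (simp add: power_mult_distrib)
  qed
  then show ?thesis by (rule order_at_0I)
qed

lemma order_at_0_differentiable:
  assumes "f differentiable (at u)" "order_at_0 1 (\<lambda>h. x h - u)"
  shows "order_at_0 1 (\<lambda>h. f (x h) - f u)"
proof -
  obtain C where "\<forall>\<^sub>F y in nhds u. norm (f y - f u) \<le> C * norm (y - u)"
    using differentiable_imp_locally_Lipschitz_at[OF assms(1)] by blast
  then show ?thesis
    using order_at_0_compose[OF assms(2), where f = "\<lambda>y. f y - f u" and C = C and j = 1] by simp
qed

section \<open>The expansion of one nonlinear step\<close>

lemma imex_remainder:
  fixes h :: real and u a b p q r f f' g g' g'' d :: "real^'n"
  shows "(u + h *\<^sub>R a + (h\<^sup>2 / 6) *\<^sub>R (f + 2 *\<^sub>R f') + h *\<^sub>R d - (h\<^sup>2 / 6) *\<^sub>R (g'' + 2 *\<^sub>R g'))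
      - (u + h *\<^sub>R (a + b) + (h\<^sup>2 / 2) *\<^sub>R (f + p + q + g) + (h\<^sup>2 / 2) *\<^sub>R (q - p))
    = h *\<^sub>R (d - b - r) + h *\<^sub>R (r - h *\<^sub>R q - h *\<^sub>R g)
      + h\<^sup>2 *\<^sub>R ((1/3) *\<^sub>R (f' - f) - (1/6) *\<^sub>R (g'' - g) - (1/3) *\<^sub>R (g' - g))"
proof -
  \<comment> \<open>The identity is proved for real numbers, where field arithmetic applies, and
    then read componentwise. In its use \<open>a\<close>, \<open>b\<close> are F and G at
    \<open>u\<close>, \<open>p\<close>, \<open>q\<close> are F_U G and G_U F, \<open>f\<close>,
    \<open>f'\<close> and \<open>g\<close>, \<open>g'\<close>, \<open>g''\<close> are self
    derivatives, \<open>d\<close> is G at the new value and \<open>r\<close> is G_U applied to the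
    increment.\<close>
  have "(u + h * a + (h\<^sup>2 / 6) * (f + 2 * f') + h * d - (h\<^sup>2 / 6) * (g'' + 2 * g'))
      - (u + h * (a + b) + (h\<^sup>2 / 2) * (f + p + q + g) + (h\<^sup>2 / 2) * (q - p))
    = h * (d - b - r) + h * (r - h * q - h * g)
      + h\<^sup>2 * ((1/3) * (f' - f) - (1/6) * (g'' - g) - (1/3) * (g' - g))"
    for u a b p q r f f' g g' g'' d :: real
    by (simp add: field_simps power2_eq_square)
  then show ?thesis
    unfolding vec_eq_iff
    by (simp only: vector_add_component vector_minus_component vector_scaleR_component real_scaleR_def simp_thms)
qed

text \<open>Bootstrap: bounded values give increments of order h, these give the new value up to
  order h^2, and inserting that into the linearised implicit term gives it up to order h^3. The
  commutator-like term remains because the G_U F contribution arises in full from the implicit term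
  while the F_U G contribution never appears.\<close>

lemma imex_step_expansion:
  fixes F G :: "real^'n \<Rightarrow> real^'n"
  assumes S: "open S" "C2_on F S" "C2_on G S" "u \<in> S"
    and K: "compact K" "K \<subseteq> S"
    and step: "\<forall>\<^sub>F h in at_right 0. x h \<in> K \<and> y h \<in> K \<and> imex_step F G h u (x h) (y h)"
  defines "H \<equiv> \<lambda>v. F v + G v"
  shows "order_at_0 3 (\<lambda>h. y h - (u + h *\<^sub>R H u + (h\<^sup>2 / 2) *\<^sub>R (jacobian H (at u) *v H u)
           + (h\<^sup>2 / 2) *\<^sub>R (jacobian G (at u) *v F u - jacobian F (at u) *v G u)))"
proof -
  let ?sF = "self_derivative F" and ?sG = "self_derivative G"
  let ?JF = "jacobian F (at u)" and ?JG = "jacobian G (at u)"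
  note dF = C2_on_imp_differentiable[OF S(2)] C2_on_imp_self_derivative_differentiable[OF S(2)]
  note dG = C2_on_imp_differentiable[OF S(3)] C2_on_imp_self_derivative_differentiable[OF S(3)]
  have cont: "continuous_on K f" if "\<And>v. v \<in> S \<Longrightarrow> f differentiable (at v)" for f :: "real^'n \<Rightarrow> real^'n"
    using that K(2)
    by (intro differentiable_imp_continuous_on) (auto simp: differentiable_on_def intro: differentiable_at_withinI)
  have inK: "\<forall>\<^sub>F h in at_right 0. x h \<in> K" "\<forall>\<^sub>F h in at_right 0. y h \<in> K"
    and stp: "\<forall>\<^sub>F h in at_right 0. imex_step F G h u (x h) (y h)"
    using step by (auto elim: eventually_mono)
  note zero_order = order_at_0_compact[OF K(1) cont[OF dG(1)] inK(1)]
    order_at_0_compact[OF K(1) cont[OF dF(3)] inK(1)] order_at_0_compact[OF K(1) cont[OF dG(3)] inK(1)]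
    order_at_0_compact[OF K(1) cont[OF dG(1)] inK(2)] order_at_0_compact[OF K(1) cont[OF dG(3)] inK(2)]
  \<comment> \<open>The scaling rule is instantiated for exactly the prefactors and orders that
    occur, so that \<open>intro\<close> can take each remainder apart.\<close>
  note arith = order_at_0_add order_at_0_diff order_at_0_scaleR order_at_0_const zero_order
    order_at_0_scaleR_power[where j = 1 and m = 1 and k = 0, unfolded power_one_right]
    order_at_0_scaleR_power[where j = 1 and m = 2 and k = 1, unfolded power_one_right]
    order_at_0_scaleR_power[where j = 1 and m = 3 and k = 2, unfolded power_one_right]
    order_at_0_scaleR_power[where j = 2 and m = 1 and k = 0]
    order_at_0_scaleR_power[where j = 2 and m = 2 and k = 0]
    order_at_0_scaleR_power[where j = 2 and m = 3 and k = 1]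
  have x1: "order_at_0 1 (\<lambda>h. x h - u)"
  proof (rule order_at_0_cong)
    show "\<forall>\<^sub>F h in at_right 0. x h - u =
        h *\<^sub>R ((1/2) *\<^sub>R (F u + G (x h))) + h\<^sup>2 *\<^sub>R ((1/8) *\<^sub>R (?sF u - ?sG (x h)))"
      using stp by eventually_elim (auto simp: imex_step_def algebra_simps)
  qed (intro arith; simp)
  have y1: "order_at_0 1 (\<lambda>h. y h - u)"
  proof (rule order_at_0_cong)
    show "\<forall>\<^sub>F h in at_right 0. y h - u = h *\<^sub>R (F u + G (y h))
        + h\<^sup>2 *\<^sub>R ((1/6) *\<^sub>R (?sF u + 2 *\<^sub>R ?sF (x h) - (?sG (y h) + 2 *\<^sub>R ?sG (x h))))"
      using stp by eventually_elim (auto simp: imex_step_def algebra_simps)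
  qed (intro arith; simp)
  note increment = order_at_0_differentiable[OF _ x1] order_at_0_differentiable[OF _ y1]
  have one_order: "order_at_0 1 (\<lambda>h. ?sF (x h) - ?sF u)" "order_at_0 1 (\<lambda>h. ?sG (x h) - ?sG u)"
      "order_at_0 1 (\<lambda>h. ?sG (y h) - ?sG u)" "order_at_0 1 (\<lambda>h. G (y h) - G u)"
    by (intro increment dF dG S(4))+
  \<comment> \<open>Second round: the increment of \<open>G\<close> is now known to be O(h), so
    replacing \<open>G (y h)\<close> by \<open>G u\<close> costs only O(h^2).\<close>
  have y2: "order_at_0 2 (\<lambda>h. y h - u - h *\<^sub>R H u)"
  proof (rule order_at_0_cong)
    show "\<forall>\<^sub>F h in at_right 0. y h - u - h *\<^sub>R H u = h *\<^sub>R (G (y h) - G u)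
        + h\<^sup>2 *\<^sub>R ((1/6) *\<^sub>R (?sF u + 2 *\<^sub>R ?sF (x h) - (?sG (y h) + 2 *\<^sub>R ?sG (x h))))"
      using stp by eventually_elim (auto simp: imex_step_def H_def algebra_simps)
  qed (intro arith one_order; simp)
  obtain C where C: "\<forall>\<^sub>F v in nhds u. norm (G v - G u - ?JG *v (v - u)) \<le> C * norm (v - u) ^ 2"
    by (rule taylor_bound_second_order[OF eventually_mono[OF eventually_nhds_in_open[OF S(1,4)] dG(1)]
          dG(2)[OF S(4)]])
  have G2: "order_at_0 2 (\<lambda>h. G (y h) - G u - ?JG *v (y h - u))"
    by (rule order_at_0_compose[OF y1 C])
  have JH: "jacobian H (at u) *v v = ?JF *v v + ?JG *v v" for v
  proof -
    have "(H has_derivative (\<lambda>v. ?JF *v v + ?JG *v v)) (at u)"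
      unfolding H_def using dF(1)[OF S(4)] dG(1)[OF S(4)] unfolding jacobian_works
      by (rule has_derivative_add)
    moreover from this have "(H has_derivative ((*v) (jacobian H (at u)))) (at u)"
      using jacobian_works by (blast intro: differentiableI)
    ultimately have "(\<lambda>v. ?JF *v v + ?JG *v v) = (*v) (jacobian H (at u))"
      by (rule has_derivative_unique)
    from fun_cong[OF this, of v] show ?thesis by simp
  qed
  show ?thesis
  proof (rule order_at_0_cong)
    show "\<forall>\<^sub>F h in at_right 0. y h - (u + h *\<^sub>R H u + (h\<^sup>2 / 2) *\<^sub>R (jacobian H (at u) *v H u)
           + (h\<^sup>2 / 2) *\<^sub>R (?JG *v F u - ?JF *v G u))
      = h *\<^sub>R (G (y h) - G u - ?JG *v (y h - u)) + h *\<^sub>R (?JG *v (y h - u - h *\<^sub>R H u))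
        + h\<^sup>2 *\<^sub>R ((1/3) *\<^sub>R (?sF (x h) - ?sF u) - (1/6) *\<^sub>R (?sG (y h) - ?sG u)
          - (1/3) *\<^sub>R (?sG (x h) - ?sG u))"
      using stp
    proof eventually_elim
      case (elim h)
      have e1: "?JG *v (y h - u - h *\<^sub>R H u) = ?JG *v (y h - u) - h *\<^sub>R (?JG *v F u) - h *\<^sub>R ?sG u"
        unfolding H_def self_derivative_def
        by (simp add: matrix_vector_mult_diff_distrib matrix_vector_right_distrib matrix_vector_mult_scaleR algebra_simps)
      have e2: "jacobian H (at u) *v H u = ?sF u + ?JF *v G u + ?JG *v F u + ?sG u"
        unfolding JH unfolding H_def self_derivative_def
        by (simp add: matrix_vector_right_distrib algebra_simps)
      \<comment> \<open>The equation for \<open>y h\<close> contains \<open>y h\<close> on its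
        right-hand side. Naming these occurrences allows it to be unfolded exactly once.\<close>
      define P gy sy where "P = ?JG *v (y h - u)" and "gy = G (y h)" and "sy = ?sG (y h)"
      have y: "y h = u + h *\<^sub>R F u + (h\<^sup>2 / 6) *\<^sub>R (?sF u + 2 *\<^sub>R ?sF (x h))
            + h *\<^sub>R gy - (h\<^sup>2 / 6) *\<^sub>R (sy + 2 *\<^sub>R ?sG (x h))"
        unfolding gy_def sy_def using elim by (simp add: imex_step_def)
      have "y h - (u + h *\<^sub>R (F u + G u) + (h\<^sup>2 / 2) *\<^sub>R (?sF u + ?JF *v G u + ?JG *v F u + ?sG u)
           + (h\<^sup>2 / 2) *\<^sub>R (?JG *v F u - ?JF *v G u))
      = h *\<^sub>R (gy - G u - P) + h *\<^sub>R (P - h *\<^sub>R (?JG *v F u) - h *\<^sub>R ?sG u)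
        + h\<^sup>2 *\<^sub>R ((1/3) *\<^sub>R (?sF (x h) - ?sF u) - (1/6) *\<^sub>R (sy - ?sG u)
          - (1/3) *\<^sub>R (?sG (x h) - ?sG u))"
        unfolding y by (rule imex_remainder)
      then show ?case unfolding e1 e2 unfolding H_def P_def gy_def sy_def .
    qed
  qed (intro arith one_order G2 order_at_0_bounded_linear[OF matrix_vector_mul_bounded_linear] y2; simp)
qed

subsection \<open>Linear fields: the local error\<close>

lemma norm_triangle_mono_diff: "norm a \<le> r \<Longrightarrow> norm b \<le> s \<Longrightarrow> norm (a - b) \<le> r + s"
  for a b :: "'a::real_normed_vector"
  using norm_triangle_ineq4[of a b] by linarith

lemma norm_scaleR_mono: "0 \<le> c \<Longrightarrow> norm a \<le> r \<Longrightarrow> norm (c *\<^sub>R a) \<le> c * r"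
  for a :: "'a::real_normed_vector"
  by (simp add: mult_left_mono)

text \<open>These rules follow the shape of a linear combination and build its bound from bounds of
  the atoms.\<close>

lemmas norm_mono = norm_triangle_mono norm_triangle_mono_diff norm_scaleR_mono

text \<open>The step size is absorbed into \<open>f\<close> and \<open>g\<close>, so that \<open>b\<close> is of order \<open>h\<close>.\<close>

lemma linear_imex_estimate:
  fixes f g :: "'a::real_normed_vector \<Rightarrow> 'a"
  assumes "linear f" "linear g" and b: "0 \<le> b" "b \<le> 1/4"
    and f: "\<And>v. norm (f v) \<le> b * norm v" and g: "\<And>v. norm (g v) \<le> b * norm v"
    and x: "x = u + (1/2) *\<^sub>R f u + (1/8) *\<^sub>R f (f u) + (1/2) *\<^sub>R g x - (1/8) *\<^sub>R g (g x)"
    and y: "y = u + f u + (1/6) *\<^sub>R (f (f u) + 2 *\<^sub>R f (f x)) + g y - (1/6) *\<^sub>R (g (g y) + 2 *\<^sub>R g (g x))"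
  shows "norm (y - (u + (f u + g u) + (1/2) *\<^sub>R (f (f u) + 2 *\<^sub>R g (f u) + g (g u)))) \<le> 8 * b ^ 3 * norm u"
proof -
  interpret f: linear f by fact
  interpret g: linear g by fact
  have ff: "norm (f (f v)) \<le> b\<^sup>2 * norm v" and gg: "norm (g (g v)) \<le> b\<^sup>2 * norm v" for v
    using order_trans[OF f mult_left_mono[OF f b(1)]] order_trans[OF g mult_left_mono[OF g b(1)]]
    by (auto simp: power2_eq_square mult_ac)
  have b2: "b\<^sup>2 \<le> (1/4) * b" using b mult_right_mono[of b "1/4" b] by (simp add: power2_eq_square)
  have bv: "b * norm v \<le> (1/4) * norm v" "b\<^sup>2 * norm v \<le> (1/4) * (b * norm v)" "0 \<le> b * norm v" for v :: 'a
    using b mult_right_mono[OF b(2), of "norm v"] mult_right_mono[OF b2, of "norm v"] by auto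
  note lin = bv[of u] bv[of x] bv[of y] norm_ge_zero[of u]
  \<comment> \<open>Since \<open>b\<close> \<le> 1/4, the terms in \<open>norm x\<close> on the
    right are a small fraction of \<open>norm x\<close> and can be absorbed on the left. The bound
    for \<open>y\<close> works in the same way.\<close>
  have "norm x \<le> norm u + (1/2) * (b * norm u) + (1/8) * (b\<^sup>2 * norm u)
      + (1/2) * (b * norm x) + (1/8) * (b\<^sup>2 * norm x)"
    by (subst x) (intro norm_mono f g ff gg order_refl; simp)
  with lin have x_bound: "norm x \<le> 2 * norm u" by linarith
  have bx: "b * norm x \<le> 2 * (b * norm u)" "b\<^sup>2 * norm x \<le> 2 * (b\<^sup>2 * norm u)"
    using mult_left_mono[OF x_bound b(1)] mult_left_mono[OF x_bound, of "b\<^sup>2"] by auto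
  have "x - u = (1/2) *\<^sub>R f u + (1/8) *\<^sub>R f (f u) + (1/2) *\<^sub>R g x - (1/8) *\<^sub>R g (g x)"
    by (subst x) simp
  then have "norm (x - u) \<le> (1/2) * (b * norm u) + (1/8) * (b\<^sup>2 * norm u)
      + (1/2) * (b * norm x) + (1/8) * (b\<^sup>2 * norm x)"
    by (simp only:) (intro norm_mono f g ff gg; simp)
  with lin bx have xu: "norm (x - u) \<le> 2 * (b * norm u)" by linarith
  have yu: "y - u = f u + (1/6) *\<^sub>R (f (f u) + 2 *\<^sub>R f (f x)) + g y - (1/6) *\<^sub>R (g (g y) + 2 *\<^sub>R g (g x))"
    by (subst y) simp
  then have y_diff: "norm (y - u) \<le> b * norm u + (1/6) * (b\<^sup>2 * norm u + 2 * (b\<^sup>2 * norm x))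
      + b * norm y + (1/6) * (b\<^sup>2 * norm y + 2 * (b\<^sup>2 * norm x))"
    by (simp only:) (intro norm_mono f g ff gg; simp)
  have "norm y \<le> norm u + norm (y - u)" using norm_triangle_ineq[of u "y - u"] by simp
  with y_diff bx have "norm y \<le> norm u + b * norm u + (9/6) * (b\<^sup>2 * norm u) + b * norm y + (1/6) * (b\<^sup>2 * norm y)"
    by (simp add: algebra_simps)
  with bv(1,2)[of u] bv(1,2)[of y] norm_ge_zero[of u] have y_bound: "norm y \<le> 2 * norm u" by linarith
  have y_bounds: "b * norm y \<le> 2 * (b * norm u)" "b\<^sup>2 * norm y \<le> 2 * (b\<^sup>2 * norm u)"
    using mult_left_mono[OF y_bound b(1)] mult_left_mono[OF y_bound, of "b\<^sup>2"] by auto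
  from y_diff bx y_bounds have "norm (y - u) \<le> 3 * (b * norm u) + (11/6) * (b\<^sup>2 * norm u)"
    by (simp add: algebra_simps)
  with bv[of u] have y_diff: "norm (y - u) \<le> 4 * (b * norm u)" by linarith
  \<comment> \<open>The defect of the explicit first-order prediction. It has size b^2, so it
    expands the implicit term \<open>g y\<close> up to an error of size b^3.\<close>
  define r where "r = y - u - f u - g u"
  have "r = g (y - u) + (1/6) *\<^sub>R (f (f u) + 2 *\<^sub>R f (f x)) - (1/6) *\<^sub>R (g (g y) + 2 *\<^sub>R g (g x))"
    unfolding r_def g.diff by (subst yu) simp
  then have "norm r \<le> b * norm (y - u) + (1/6) * (b\<^sup>2 * norm u + 2 * (b\<^sup>2 * norm x))
      + (1/6) * (b\<^sup>2 * norm y + 2 * (b\<^sup>2 * norm x))"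
    by (simp only:) (intro norm_mono f g ff gg; simp)
  moreover have "b * norm (y - u) \<le> 4 * (b\<^sup>2 * norm u)"
    using mult_left_mono[OF y_diff b(1)] by (simp add: power2_eq_square mult_ac)
  ultimately have "norm r \<le> (35/6) * (b\<^sup>2 * norm u)" using bx(2) y_bounds(2) by (simp add: algebra_simps)
  then have r: "norm r \<le> 6 * (b\<^sup>2 * norm u)"
    using mult_nonneg_nonneg[OF zero_le_power2[of b] norm_ge_zero[of u]] by linarith
  have gy: "g y = g u + g (f u) + g (g u) + g r"
    unfolding r_def by (simp add: g.diff)
  \<comment> \<open>Each term on the right is of third order: one map applied to a second-order
    defect, or two maps applied to a first-order increment.\<close>
  have "y - (u + (f u + g u) + (1/2) *\<^sub>R (f (f u) + 2 *\<^sub>R g (f u) + g (g u)))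
    = g r + (1/3) *\<^sub>R f (f (x - u)) - (1/6) *\<^sub>R g (g (y - u)) - (1/3) *\<^sub>R g (g (x - u))" (is "_ = ?R")
  proof -
    have "y - (u + (f u + g u) + (1/2) *\<^sub>R (f (f u) + 2 *\<^sub>R g (f u) + g (g u)))
      = (y - u) - ((f u + g u) + (1/2) *\<^sub>R (f (f u) + 2 *\<^sub>R g (f u) + g (g u)))" by simp
    also have "\<dots> = f u + (1/6) *\<^sub>R (f (f u) + 2 *\<^sub>R f (f x)) + (g u + g (f u) + g (g u) + g r)
       - (1/6) *\<^sub>R (g (g y) + 2 *\<^sub>R g (g x)) - ((f u + g u) + (1/2) *\<^sub>R (f (f u) + 2 *\<^sub>R g (f u) + g (g u)))"
      unfolding yu gy[symmetric] ..
    also have "\<dots> = g r + (1/3) *\<^sub>R (f (f x) - f (f u)) - (1/6) *\<^sub>R (g (g y) - g (g u)) - (1/3) *\<^sub>R (g (g x) - g (g u))"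
    proof -
      \<comment> \<open>Multiplying by 6 clears all fractions; the integer multiples are then
        written as sums.\<close>
      have "6 *\<^sub>R (f u + (1/6) *\<^sub>R (F + 2 *\<^sub>R F') + (g u + p + q + g r)
       - (1/6) *\<^sub>R (q'' + 2 *\<^sub>R q') - ((f u + g u) + (1/2) *\<^sub>R (F + 2 *\<^sub>R p + q)))
       = 6 *\<^sub>R (g r + (1/3) *\<^sub>R (F' - F) - (1/6) *\<^sub>R (q'' - q) - (1/3) *\<^sub>R (q' - q))" for F F' p q q' q'' :: 'a
      proof -
        have "6 *\<^sub>R v = (1 + 1 + 1 + 1 + 1 + 1) *\<^sub>R v" "3 *\<^sub>R v = (1 + 1 + 1) *\<^sub>R v" for v :: 'a
          by simp_all
        note multiples = this[unfolded scaleR_left_distrib scaleR_one] scaleR_2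
        show ?thesis
          by (simp add: scaleR_right_distrib scaleR_right_diff_distrib)
             (simp add: multiples algebra_simps)
      qed
      then show ?thesis by (metis real_vector.scale_left_imp_eq zero_neq_numeral)
    qed
    also have "\<dots> = ?R" by (simp add: f.diff g.diff)
    finally show ?thesis .
  qed
  also have "norm ?R \<le> b * norm r + (1/3) * (b\<^sup>2 * norm (x - u)) + (1/6) * (b\<^sup>2 * norm (y - u)) + (1/3) * (b\<^sup>2 * norm (x - u))"
    by (intro norm_mono f g ff gg; simp)
  \<comment> \<open>The constant is 6 + 2/3 + 4/6 + 2/3 = 8.\<close>
  also have "\<dots> \<le> 8 * b ^ 3 * norm u"
  proof -
    have "b * norm r \<le> 6 * (b ^ 3 * norm u)"
      using mult_left_mono[OF r b(1)] by (simp add: power2_eq_square power3_eq_cube mult_ac)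
    moreover have "b\<^sup>2 * norm (x - u) \<le> 2 * (b ^ 3 * norm u)"
      using mult_left_mono[OF xu, of "b\<^sup>2"] by (simp add: power2_eq_square power3_eq_cube mult_ac)
    moreover have "b\<^sup>2 * norm (y - u) \<le> 4 * (b ^ 3 * norm u)"
      using mult_left_mono[OF y_diff, of "b\<^sup>2"] by (simp add: power2_eq_square power3_eq_cube mult_ac)
    ultimately show ?thesis by linarith
  qed
  finally show ?thesis .
qed

lemma self_derivative_linear: "self_derivative ((*v) A) u = A *v (A *v u)"
proof -
  have "((*v) A has_derivative (*v) A) (at u)"
    by (rule bounded_linear_imp_has_derivative) simp
  then have "(*v) A = (*v) (jacobian ((*v) A) (at u))"
    using jacobian_works has_derivative_unique by (blast intro: differentiableI)
  from fun_cong[OF this, of "A *v u"] show ?thesis by (simp add: self_derivative_def)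
qed

text \<open>The method produces A^2 + 2BA + B^2 = (A + B)^2 - [A,B] at second order. The bound is
  uniform in the starting value and proportional to its norm, because the global analysis applies it
  along a whole trajectory.\<close>

lemma imex_step_linear_estimate:
  fixes A B :: "real^'n^'n"
  obtains K where "K \<ge> 0"
    "\<forall>\<^sub>F h in at_right 0. \<forall>u us un. imex_step (\<lambda>v. A *v v) (\<lambda>v. B *v v) h u us un \<longrightarrow>
      norm (un - (u + h *\<^sub>R ((A + B) *v u) + (h\<^sup>2 / 2) *\<^sub>R ((A + B) *v ((A + B) *v u) - commutator A B *v u)))
        \<le> K * h ^ 3 * norm u"
proof -
  obtain a where a: "a > 0" "\<And>v. norm (A *v v) \<le> norm v * a"
    using bounded_linear.pos_bounded[OF matrix_vector_mul_bounded_linear] by blast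
  obtain b where b: "b > 0" "\<And>v. norm (B *v v) \<le> norm v * b"
    using bounded_linear.pos_bounded[OF matrix_vector_mul_bounded_linear] by blast
  let ?c = "a + b"
  have bound: "norm (A *v v) \<le> ?c * norm v" "norm (B *v v) \<le> ?c * norm v" for v
    using order_trans[OF a(2)[of v] mult_left_mono[of a ?c "norm v"]]
      order_trans[OF b(2)[of v] mult_left_mono[of b ?c "norm v"]] a(1) b(1) by (simp_all add: mult.commute)
  have "\<forall>\<^sub>F h in at_right 0. \<forall>u us un. imex_step (\<lambda>v. A *v v) (\<lambda>v. B *v v) h u us un \<longrightarrow>
      norm (un - (u + h *\<^sub>R ((A + B) *v u) + (h\<^sup>2 / 2) *\<^sub>R ((A + B) *v ((A + B) *v u) - commutator A B *v u)))
        \<le> (8 * ?c ^ 3) * h ^ 3 * norm u"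
  proof (rule eventually_mono[OF eventually_at_right_real])
    \<comment> \<open>The step is restricted so that \<open>h * ?c\<close> \<le> 1/4, the smallness
      used to absorb the implicit terms.\<close>
    show "0 < 1 / (4 * ?c)" using a b by simp
    fix h assume "h \<in> {0<..<1 / (4 * ?c)}"
    then have h: "0 < h" "h * ?c \<le> 1/4" using a b by (auto simp: field_simps)
    show "\<forall>u us un. imex_step (\<lambda>v. A *v v) (\<lambda>v. B *v v) h u us un \<longrightarrow>
      norm (un - (u + h *\<^sub>R ((A + B) *v u) + (h\<^sup>2 / 2) *\<^sub>R ((A + B) *v ((A + B) *v u) - commutator A B *v u)))
        \<le> (8 * ?c ^ 3) * h ^ 3 * norm u"
    proof (intro allI impI)
      fix u us un assume step: "imex_step (\<lambda>v. A *v v) (\<lambda>v. B *v v) h u us un"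
      let ?f = "\<lambda>v. h *\<^sub>R (A *v v)" and ?g = "\<lambda>v. h *\<^sub>R (B *v v)"
      have estimate: "norm (un - (u + (?f u + ?g u) + (1/2) *\<^sub>R (?f (?f u) + 2 *\<^sub>R ?g (?f u) + ?g (?g u))))
          \<le> 8 * (h * ?c) ^ 3 * norm u"
      proof (rule linear_imex_estimate)
        show "linear ?f" "linear ?g"
          by (auto intro!: linearI simp: matrix_vector_right_distrib matrix_vector_mult_scaleR scaleR_right_distrib)
        show "0 \<le> h * ?c" "h * ?c \<le> 1/4" using h a b by auto
        show "norm (?f v) \<le> h * ?c * norm v" "norm (?g v) \<le> h * ?c * norm v" for v
          using h mult_left_mono[OF bound(1)[of v], of h] mult_left_mono[OF bound(2)[of v], of h]
          by (simp_all add: mult_ac)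
        show "us = u + (1/2) *\<^sub>R ?f u + (1/8) *\<^sub>R ?f (?f u) + (1/2) *\<^sub>R ?g us - (1/8) *\<^sub>R ?g (?g us)"
          using step by (simp add: imex_step_def self_derivative_linear matrix_vector_mult_scaleR power2_eq_square)
        show "un = u + ?f u + (1/6) *\<^sub>R (?f (?f u) + 2 *\<^sub>R ?f (?f us)) + ?g un - (1/6) *\<^sub>R (?g (?g un) + 2 *\<^sub>R ?g (?g us))"
          using step by (simp add: imex_step_def self_derivative_linear matrix_vector_mult_scaleR power2_eq_square scaleR_right_distrib mult_ac)
      qed
      have expand: "u + (?f u + ?g u) + (1/2) *\<^sub>R (?f (?f u) + 2 *\<^sub>R ?g (?f u) + ?g (?g u))
        = u + h *\<^sub>R ((A + B) *v u) + (h\<^sup>2 / 2) *\<^sub>R ((A + B) *v ((A + B) *v u) - commutator A B *v u)"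
      proof -
        have "(A + B) *v ((A + B) *v u) - commutator A B *v u
            = A *v (A *v u) + 2 *\<^sub>R (B *v (A *v u)) + B *v (B *v u)"
          by (simp add: commutator_def matrix_vector_right_distrib matrix_vector_mult_add_rdistrib
              matrix_vector_mult_diff_rdistrib scaleR_2 flip: matrix_vector_mul_assoc)
        then show ?thesis
          by (simp only:) (simp add: matrix_vector_mult_scaleR power2_eq_square matrix_vector_mult_add_rdistrib scaleR_right_distrib)
      qed
      show "norm (un - (u + h *\<^sub>R ((A + B) *v u) + (h\<^sup>2 / 2) *\<^sub>R ((A + B) *v ((A + B) *v u) - commutator A B *v u)))
        \<le> (8 * ?c ^ 3) * h ^ 3 * norm u"
        using estimate unfolding expand by (simp add: power_mult_distrib mult_ac)
    qed
  qed
  then show thesis using that[of "8 * ?c ^ 3"] a b by simp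
qed

section \<open>Taylor bounds for linear differential equations and the linear local error\<close>

lemma norm_bound_vector_derivative:
  fixes f :: "real \<Rightarrow> 'a::real_normed_vector"
  assumes "\<And>s. s \<in> {a..b} \<Longrightarrow> (f has_vector_derivative f' s) (at s within {a..b})"
    and "\<And>s. s \<in> {a..b} \<Longrightarrow> norm (f' s) \<le> B" and "s \<in> {a..b}"
  shows "norm (f s - f a) \<le> B * (s - a)"
proof -
  have "norm (f s - f a) \<le> B * norm (s - a)"
  proof (rule differentiable_bound[of "{a..b}"])
    show "onorm (\<lambda>t. t *\<^sub>R f' r) \<le> B" if "r \<in> {a..b}" for r
      using assms(2)[OF that] by (intro onorm_le) (simp add: mult.commute[of B] mult_left_mono)
  qed (use assms in \<open>auto simp: has_vector_derivative_def\<close>)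
  then show ?thesis using assms(3) by simp
qed

text \<open>The derivative of each Taylor remainder is \<open>f\<close> applied to the preceding
  remainder, so every use of the mean value inequality gains a factor \<open>b * h\<close>.
  Replacing \<open>s - t\<close> by \<open>h\<close> gives up the factorials in the
  constants.\<close>

lemma linear_ode_expansion:
  fixes f :: "'a::real_normed_vector \<Rightarrow> 'a"
  assumes f: "bounded_linear f" "\<And>v. norm (f v) \<le> b * norm v" and "0 \<le> b" "0 \<le> h"
    and ode: "\<And>s. s \<in> {t..t + h} \<Longrightarrow> (z has_vector_derivative f (z s)) (at s within {t..t + h})"
    and R: "\<And>s. s \<in> {t..t + h} \<Longrightarrow> norm (z s) \<le> R"
  shows "norm (z (t + h) - (z t + h *\<^sub>R f (z t))) \<le> b\<^sup>2 * R * h\<^sup>2"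
    and "norm (z (t + h) - (z t + h *\<^sub>R f (z t) + (h\<^sup>2 / 2) *\<^sub>R f (f (z t)))) \<le> b ^ 3 * R * h ^ 3"
proof -
  interpret f: bounded_linear f by fact
  have R0: "0 \<le> R" using order_trans[OF norm_ge_zero R[of t]] \<open>0 \<le> h\<close> by simp
  have ends: "t + h \<in> {t..t + h}" using \<open>0 \<le> h\<close> by simp
  have fR: "norm (f v) \<le> b * C" if "norm v \<le> C" for v C
    using f(2)[of v] mult_left_mono[OF that \<open>0 \<le> b\<close>] by linarith
  have widen: "C * (s - t) \<le> C * h" if "0 \<le> C" "s \<in> {t..t + h}" for C s
    using that by (intro mult_left_mono) auto
  have first: "norm (z s - z t) \<le> (b * R) * h" if "s \<in> {t..t + h}" for s
    using norm_bound_vector_derivative[OF ode fR[OF R] that] widen[OF mult_nonneg_nonneg[OF \<open>0 \<le> b\<close> R0] that] by simp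
  have second: "norm (z s - (z t + (s - t) *\<^sub>R f (z t))) \<le> (b * (b * R * h)) * h" if s: "s \<in> {t..t + h}" for s
  proof -
    let ?r = "\<lambda>s. z s - (s - t) *\<^sub>R f (z t)"
    have "norm (?r s - ?r t) \<le> (b * (b * R * h)) * (s - t)"
    proof (rule norm_bound_vector_derivative[OF _ _ s])
      fix s assume s: "s \<in> {t..t + h}"
      show "(?r has_vector_derivative f (z s - z t)) (at s within {t..t + h})"
        by (auto intro!: derivative_eq_intros ode[OF s] simp: f.diff)
      show "norm (f (z s - z t)) \<le> b * (b * R * h)" by (rule fR[OF first[OF s]])
    qed
    then show ?thesis using widen[OF _ s, of "b * (b * R * h)"] R0 assms(3,4) by (simp add: algebra_simps)
  qed
  from second[OF ends] show "norm (z (t + h) - (z t + h *\<^sub>R f (z t))) \<le> b\<^sup>2 * R * h\<^sup>2"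
    by (simp add: power2_eq_square mult_ac)
  let ?r = "\<lambda>s. z s - (s - t) *\<^sub>R f (z t) - ((s - t)\<^sup>2 / 2) *\<^sub>R f (f (z t))"
  have "norm (?r (t + h) - ?r t) \<le> (b * ((b * (b * R * h)) * h)) * (t + h - t)"
  proof (rule norm_bound_vector_derivative[OF _ _ ends])
    fix s assume s: "s \<in> {t..t + h}"
    show "(?r has_vector_derivative f (z s - (z t + (s - t) *\<^sub>R f (z t)))) (at s within {t..t + h})"
      by (auto intro!: derivative_eq_intros ode[OF s] simp: f.diff f.add f.scaleR)
    show "norm (f (z s - (z t + (s - t) *\<^sub>R f (z t)))) \<le> b * ((b * (b * R * h)) * h)"
      by (rule fR[OF second[OF s]])
  qed
  then show "norm (z (t + h) - (z t + h *\<^sub>R f (z t) + (h\<^sup>2 / 2) *\<^sub>R f (f (z t)))) \<le> b ^ 3 * R * h ^ 3"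
    by (simp add: power3_eq_cube algebra_simps)
qed

text \<open>The numerical and exact expansions agree except for the commutator term, so subtracting
  them leaves two third-order remainders.\<close>

lemma imex_linear_local_error:
  fixes A B :: "real^'n^'n"
  assumes "0 < \<delta>" and U: "exact_solution (\<lambda>v. A *v v + B *v v) {t..t + \<delta>} U"
    and step: "\<forall>\<^sub>F h in at_right 0. imex_step (\<lambda>v. A *v v) (\<lambda>v. B *v v) h (U t) (x h) (y h)"
  shows "order_at_0 3 (\<lambda>h. (y h - U (t + h)) - (- (h\<^sup>2 / 2)) *\<^sub>R (commutator A B *v U t))"
proof -
  let ?M = "A + B"
  obtain b where b: "b \<ge> 0" "\<And>v. norm (?M *v v) \<le> b * norm v"
    using bounded_linear.nonneg_bounded[OF matrix_vector_mul_bounded_linear[of ?M]] by (metis mult.commute)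
  obtain K where K: "K \<ge> 0"
    "\<forall>\<^sub>F h in at_right 0. \<forall>u us un. imex_step (\<lambda>v. A *v v) (\<lambda>v. B *v v) h u us un \<longrightarrow>
      norm (un - (u + h *\<^sub>R (?M *v u) + (h\<^sup>2 / 2) *\<^sub>R (?M *v (?M *v u) - commutator A B *v u)))
        \<le> K * h ^ 3 * norm u"
    by (rule imex_step_linear_estimate)
  have ode: "(U has_vector_derivative ?M *v U s) (at s within {t..t + \<delta>})" if "s \<in> {t..t + \<delta>}" for s
    using U that by (simp add: exact_solution_def matrix_vector_mult_add_rdistrib)
  have "continuous_on {t..t + \<delta>} U"
    unfolding continuous_on_eq_continuous_within
    using ode by (blast intro: has_vector_derivative_continuous)
  then have "bounded (U ` {t..t + \<delta>})"
    by (intro compact_imp_bounded compact_continuous_image) auto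
  then obtain R where R: "\<And>s. s \<in> {t..t + \<delta>} \<Longrightarrow> norm (U s) \<le> R" unfolding bounded_iff by blast
  have "\<forall>\<^sub>F h in at_right 0. norm ((y h - U (t + h)) - (- (h\<^sup>2 / 2)) *\<^sub>R (commutator A B *v U t))
      \<le> (K * norm (U t) + b ^ 3 * R) * h ^ 3"
    using K(2) step eventually_at_right_real[OF \<open>0 < \<delta>\<close>]
  proof eventually_elim
    case (elim h)
    let ?u = "U t" and ?C = "commutator A B *v U t"
    have h: "0 < h" "h < \<delta>" using elim by auto
    have 1: "norm (y h - (?u + h *\<^sub>R (?M *v ?u) + (h\<^sup>2 / 2) *\<^sub>R (?M *v (?M *v ?u) - ?C))) \<le> K * h ^ 3 * norm ?u"
      using elim by blast
    have sub: "{t..t + h} \<subseteq> {t..t + \<delta>}" using h by auto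
    have 2: "norm (U (t + h) - (?u + h *\<^sub>R (?M *v ?u) + (h\<^sup>2 / 2) *\<^sub>R (?M *v (?M *v ?u)))) \<le> b ^ 3 * R * h ^ 3"
      by (rule linear_ode_expansion(2)[OF matrix_vector_mul_bounded_linear b(2,1)])
         (use h sub in \<open>auto intro!: R has_vector_derivative_within_subset[OF ode]\<close>)
    have "(y h - U (t + h)) - (- (h\<^sup>2 / 2)) *\<^sub>R ?C
      = (y h - (?u + h *\<^sub>R (?M *v ?u) + (h\<^sup>2 / 2) *\<^sub>R (?M *v (?M *v ?u) - ?C)))
        - (U (t + h) - (?u + h *\<^sub>R (?M *v ?u) + (h\<^sup>2 / 2) *\<^sub>R (?M *v (?M *v ?u))))"
      by (simp add: scaleR_right_diff_distrib)
    then show ?case using norm_triangle_mono_diff[OF 1 2] by (simp only:) (simp add: algebra_simps)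
  qed
  then show ?thesis by (rule order_at_0I)
qed

subsection \<open>Flows of linear vector fields\<close>

text \<open>The exponential of \<open>t f\<close> applied to \<open>x\<close>, written as a series
  of vectors. The general space is needed because it is later used on pairs of vectors.\<close>

definition exp_flow :: "('a::real_normed_vector \<Rightarrow> 'a) \<Rightarrow> real \<Rightarrow> 'a \<Rightarrow> 'a" where
  "exp_flow f t x = (\<Sum>n. (t ^ n / fact n) *\<^sub>R (f ^^ n) x)"

context
  fixes f :: "'a::euclidean_space \<Rightarrow> 'a"
  assumes f: "bounded_linear f"
begin

interpretation f: bounded_linear f by (rule f)

lemma summable_exp_flow: "summable (\<lambda>n. (t ^ n / fact n) *\<^sub>R (f ^^ n) x)"
proof -
  obtain b where b: "b \<ge> 0" "\<And>v. norm (f v) \<le> norm v * b" using f.nonneg_bounded by blast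
  have pow: "norm ((f ^^ n) x) \<le> b ^ n * norm x" for n
  proof (induction n)
    case (Suc n)
    have "norm (f ((f ^^ n) x)) \<le> norm ((f ^^ n) x) * b" by (rule b(2))
    also have "\<dots> \<le> (b ^ n * norm x) * b" using Suc b(1) by (rule mult_right_mono)
    finally show ?case by (simp add: mult_ac)
  qed simp
  show ?thesis
  proof (rule summable_comparison_test')
    show "summable (\<lambda>n. norm x * (inverse (fact n) * (\<bar>t\<bar> * b) ^ n))"
      by (intro summable_mult summable_exp)
    show "norm ((t ^ n / fact n) *\<^sub>R (f ^^ n) x) \<le> norm x * (inverse (fact n) * (\<bar>t\<bar> * b) ^ n)" for n
    proof -
      have "norm ((t ^ n / fact n) *\<^sub>R (f ^^ n) x) = \<bar>t\<bar> ^ n / fact n * norm ((f ^^ n) x)"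
        by (simp add: power_abs)
      also have "\<dots> \<le> \<bar>t\<bar> ^ n / fact n * (b ^ n * norm x)" using pow by (intro mult_left_mono) auto
      finally show ?thesis by (simp add: power_mult_distrib divide_inverse mult_ac)
    qed
  qed
qed

lemma exp_flow_zero: "exp_flow f 0 x = x"
proof -
  have "exp_flow f 0 x = (\<Sum>n. if n = 0 then x else 0)"
    unfolding exp_flow_def by (intro suminf_cong) auto
  then show ?thesis using suminf_finite[of "{0::nat}" "\<lambda>n. if n = 0 then x else 0"] by simp
qed

lemma linear_exp_flow: "linear (exp_flow f t)"
proof (rule linearI)
  have pow: "linear (f ^^ n)" for n
  proof (induction n)
    case 0
    show ?case by (simp add: linear_ident)
  next
    case (Suc n)
    show ?case using linear_compose[OF Suc f.linear] by (simp add: o_def)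
  qed
  show "exp_flow f t (x + y) = exp_flow f t x + exp_flow f t y" for x y
    unfolding exp_flow_def
    by (simp add: suminf_add summable_exp_flow linear_add[OF pow] scaleR_right_distrib)
  show "exp_flow f t (c *\<^sub>R x) = c *\<^sub>R exp_flow f t x" for c x
    unfolding exp_flow_def
    by (simp add: suminf_scaleR_right summable_exp_flow linear_scale[OF pow] mult.commute)
qed

text \<open>Every component is an everywhere convergent scalar power series in \<open>t\<close>,
  which opens the way to termwise differentiation and to complex extension.\<close>

lemma exp_flow_inner:
  "exp_flow f t x \<bullet> i = (\<Sum>n. ((f ^^ n) x \<bullet> i / fact n) * t ^ n)"
  "summable (\<lambda>n. ((f ^^ n) x \<bullet> i / fact n) * t ^ n)"
  using bounded_linear.suminf[OF bounded_linear_inner_left[of i] summable_exp_flow[of t x]]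
    bounded_linear.summable[OF bounded_linear_inner_left[of i] summable_exp_flow[of t x]]
  unfolding exp_flow_def by (simp_all add: mult_ac)

text \<open>Termwise differentiation of the components yields the flow of \<open>f x\<close>, and
  \<open>f\<close> commutes with its own flow.\<close>

lemma has_vector_derivative_exp_flow:
  "((\<lambda>t. exp_flow f t x) has_vector_derivative f (exp_flow f t x)) (at t within S)"
proof -
  have commute: "f (exp_flow f t x) = exp_flow f t (f x)"
    unfolding exp_flow_def f.suminf[OF summable_exp_flow] by (simp add: f.scaleR funpow_swap1)
  have "((\<lambda>t. exp_flow f t x \<bullet> i) has_real_derivative exp_flow f t (f x) \<bullet> i) (at t)" for i
  proof -
    have "diffs (\<lambda>n. (f ^^ n) x \<bullet> i / fact n) = (\<lambda>n. (f ^^ n) (f x) \<bullet> i / fact n)"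
      by (rule ext) (simp add: diffs_def funpow_swap1 del: of_nat_Suc)
    then show ?thesis
      using termdiffs_strong_converges_everywhere[OF exp_flow_inner(2), of x i t]
      by (simp add: exp_flow_inner(1))
  qed
  then have "((\<lambda>t. exp_flow f t x) has_vector_derivative exp_flow f t (f x)) (at t)"
    unfolding has_vector_derivative_def has_derivative_componentwise_within[where f = "\<lambda>t. exp_flow f t x"]
    by (simp add: has_field_derivative_def mult_commute_abs)
  then show ?thesis unfolding commute by (rule has_vector_derivative_at_within)
qed

text \<open>Energy argument: for the difference \<open>d\<close> of two solutions, exp(-2bt) times
  the squared norm of \<open>d\<close> is nonincreasing and starts at 0.\<close>

lemma linear_ode_unique:
  assumes y: "\<And>t. 0 \<le> t \<Longrightarrow> (y has_vector_derivative f (y t)) (at t within {0..})"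
    and z: "\<And>t. 0 \<le> t \<Longrightarrow> (z has_vector_derivative f (z t)) (at t within {0..})"
    and "y 0 = z 0" "0 \<le> t"
  shows "y t = z t"
proof -
  obtain b where b: "b \<ge> 0" "\<And>v. norm (f v) \<le> norm v * b" using f.nonneg_bounded by blast
  define d where "d = (\<lambda>t. y t - z t)"
  have d: "(d has_vector_derivative f (d t)) (at t within {0..})" if "0 \<le> t" for t
    unfolding d_def f.diff using y[OF that] z[OF that] by (rule has_vector_derivative_diff)
  let ?g = "\<lambda>t. exp (- 2 * b * t) * (d t \<bullet> d t)"
  have "?g t \<le> ?g 0"
  \<comment> \<open>Derivatives are required only in the open interval, since at 0 only the
    one-sided derivative is given.\<close>
  proof (rule DERIV_nonpos_imp_decreasing_open[OF \<open>0 \<le> t\<close>])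
    have "continuous_on {0..t} d"
      unfolding continuous_on_eq_continuous_within
      using d by (auto intro!: has_vector_derivative_continuous has_vector_derivative_within_subset[OF d])
    then show "continuous_on {0..t} ?g" by (intro continuous_intros)
    fix s assume s: "0 < s" "s < t"
    have "(d has_vector_derivative f (d s)) (at s)"
      using d[of s] s at_within_interior[of s "{0..}"] by simp
    then have d': "(d has_derivative (\<lambda>h. h *\<^sub>R f (d s))) (at s)"
      by (simp add: has_vector_derivative_def)
    have "((\<lambda>t. d t \<bullet> d t) has_real_derivative 2 * (d s \<bullet> f (d s))) (at s)"
      using has_derivative_inner[OF d' d']
      by (rule has_derivative_imp_has_field_derivative) (simp add: inner_commute)
    then have "(?g has_real_derivative exp (- 2 * b * s) * (2 * (d s \<bullet> f (d s)) - 2 * b * (d s \<bullet> d s))) (at s)"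
      by (auto intro!: derivative_eq_intros simp: algebra_simps)
    moreover have "d s \<bullet> f (d s) \<le> b * (d s \<bullet> d s)"
    proof -
      have "d s \<bullet> f (d s) \<le> norm (d s) * norm (f (d s))" by (rule norm_cauchy_schwarz)
      also have "\<dots> \<le> norm (d s) * (norm (d s) * b)" using b(2) by (intro mult_left_mono) auto
      finally show ?thesis by (simp add: power2_norm_eq_inner[symmetric] power2_eq_square mult_ac)
    qed
    ultimately show "\<exists>D. (?g has_real_derivative D) (at s) \<and> D \<le> 0"
      by (intro exI conjI) (auto simp: mult_nonneg_nonpos)
  qed
  moreover have "d 0 = 0" using assms(3) by (simp add: d_def)
  ultimately have "d t \<bullet> d t \<le> 0" by (simp add: mult_le_0_iff not_le)
  then have "d t = 0" by (metis antisym inner_ge_zero inner_eq_zero_iff)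
  then show ?thesis by (simp add: d_def)
qed

text \<open>Linearity in the vector reduces joint continuity to continuity in time of finitely many
  basis trajectories.\<close>

lemma continuous_on_exp_flow: "continuous_on S (\<lambda>p. exp_flow f (fst p) (snd p))"
proof -
  have expand: "exp_flow f t x = (\<Sum>i\<in>Basis. (x \<bullet> i) *\<^sub>R exp_flow f t i)" for t x
    by (subst euclidean_representation[of x, symmetric])
       (simp only: linear_sum[OF linear_exp_flow] linear_scale[OF linear_exp_flow])
  have "continuous_on UNIV (\<lambda>t. exp_flow f t i)" for i
    unfolding continuous_on_eq_continuous_within
    by (blast intro: has_vector_derivative_continuous has_vector_derivative_exp_flow)
  then have "continuous_on S (\<lambda>p. exp_flow f (fst p) i)" for i
    by (rule continuous_on_compose2) (auto intro: continuous_intros)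
  then have "continuous_on S (\<lambda>p. \<Sum>i\<in>Basis. (snd p \<bullet> i) *\<^sub>R exp_flow f (fst p) i)"
    by (intro continuous_on_sum continuous_on_scaleR continuous_on_inner continuous_on_snd
        continuous_on_id continuous_on_const)
  then show ?thesis by (simp only: expand[symmetric])
qed

text \<open>The component extends to an entire function whose derivative at 0 is \<open>f x \<bullet> i\<close>.\<close>

lemma countable_exp_flow_zeros:
  assumes "f x \<bullet> i \<noteq> 0"
  shows "countable {t. exp_flow f t x \<bullet> i = 0}"
proof -
  define c where "c n = (f ^^ n) x \<bullet> i / fact n" for n
  define F where "F = (\<lambda>z::complex. \<Sum>n. of_real (c n) * z ^ n)"
  have summ: "summable (\<lambda>n. of_real (c n) * z ^ n)" for z :: complex
  proof (rule summable_norm_cancel)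
    have "summable (\<lambda>n. norm (c n * (norm z) ^ n))"
      \<comment> \<open>The real series converges at \<open>norm z + 1\<close>, hence absolutely at
        every complex point of modulus \<open>norm z\<close>.\<close>
      by (rule powser_insidea[of c "norm z + 1"]) (use exp_flow_inner(2) in \<open>auto simp: c_def\<close>)
    then show "summable (\<lambda>n. norm (of_real (c n) * z ^ n))" by (simp add: norm_mult norm_power abs_mult)
  qed
  have F_real: "F (of_real t) = of_real (exp_flow f t x \<bullet> i)" for t
  proof -
    have "of_real (\<Sum>n. c n * t ^ n) = (\<Sum>n. of_real (c n * t ^ n) :: complex)"
      using bounded_linear.suminf[OF bounded_linear_of_real exp_flow_inner(2)[of x i t]] unfolding c_def .
    then show ?thesis unfolding F_def exp_flow_inner(1) c_def[symmetric] by simp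
  qed
  have F': "(F has_field_derivative (\<Sum>n. diffs (\<lambda>n. of_real (c n)) n * z ^ n)) (at z)" for z
    unfolding F_def by (rule termdiffs_strong_converges_everywhere[OF summ])
  then have hol: "F holomorphic_on UNIV" by (auto simp: holomorphic_on_open)
  have "\<not> F constant_on UNIV"
  proof
    assume "F constant_on UNIV"
    then obtain k where "F = (\<lambda>_. k)" by (auto simp: constant_on_def)
    then have "(F has_field_derivative 0) (at 0)" by simp
    with F'[of 0] have "(\<Sum>n. diffs (\<lambda>n. of_real (c n)) n * 0 ^ n) = (0::complex)"
      by (rule DERIV_unique)
    then have "diffs (\<lambda>n. of_real (c n)) 0 = (0::complex)" by (simp add: powser_zero)
    then show False using assms by (simp add: diffs_def c_def)
  qed
  then have "countable {z \<in> UNIV. F z = 0}"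
    by (intro holomorphic_countable_zeros hol) auto
  moreover have "of_real ` {t. exp_flow f t x \<bullet> i = 0} \<subseteq> {z \<in> UNIV. F z = 0}"
    by (auto simp: F_real)
  ultimately have "countable ((of_real :: real \<Rightarrow> complex) ` {t. exp_flow f t x \<bullet> i = 0})"
    by (rule countable_subset[rotated])
  then show ?thesis by (rule countable_image_inj_on) (auto intro: inj_onI)
qed

end

subsection \<open>Linear fields: the global error\<close>

text \<open>Pairs are (w, y) with w' = M w + C y and y' = M y, where M = A + B and C = [A,B].
  Coupling the forced equation to its forcing makes the system homogeneous and autonomous, so that
  \<open>exp_flow\<close> solves it.\<close>

definition error_field :: "real^'n^'n \<Rightarrow> real^'n^'n \<Rightarrow> (real^'n) \<times> (real^'n) \<Rightarrow> (real^'n) \<times> (real^'n)" where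
  "error_field A B p = ((A + B) *v fst p + commutator A B *v snd p, (A + B) *v snd p)"

definition error_coefficient :: "real^'n^'n \<Rightarrow> real^'n^'n \<Rightarrow> real \<Rightarrow> real^'n \<Rightarrow> real^'n" where
  "error_coefficient A B t u = fst (exp_flow (error_field A B) t (0, u))"

text \<open>By variation of constants this is
  \<open>\<integral>\<close> of \<open>exp ((t - s) (A + B)) [A,B] exp (s (A + B)) u\<close> over \<open>s\<close> in \<open>[0, t]\<close>;
  times \<open>- h / 2\<close> it is the leading term of the global error.\<close>

lemma bounded_linear_error_field: "bounded_linear (error_field A B)"
  unfolding error_field_def[abs_def]
  by (intro bounded_linear_Pair bounded_linear_add bounded_linear_compose[OF matrix_vector_mul_bounded_linear]
      bounded_linear_fst bounded_linear_snd)

text \<open>Induction with the bound \<open>real k * d * (1 + a) ^ k\<close>: the new defect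
  \<open>d\<close> fits in because \<open>(1 + a) ^ Suc k\<close> is at least 1. The recursion is
  asked for only below \<open>n\<close>, as the local error is controlled only up to the final
  time.\<close>

lemma discrete_gronwall:
  fixes e :: "nat \<Rightarrow> real"
  assumes "e 0 \<le> 0" "0 \<le> a" "0 \<le> d" and step: "\<And>k. k < n \<Longrightarrow> e (Suc k) \<le> (1 + a) * e k + d"
  shows "e n \<le> real n * d * exp (real n * a)"
proof -
  have "e k \<le> real k * d * (1 + a) ^ k" if "k \<le> n" for k
    using that
  proof (induction k)
    case (Suc k)
    have "e (Suc k) \<le> (1 + a) * e k + d" using step Suc.prems by simp
    also have "\<dots> \<le> (1 + a) * (real k * d * (1 + a) ^ k) + d * (1 + a) ^ Suc k"
      using Suc assms(2,3) mult_left_mono[of 1 "(1 + a) ^ Suc k" d]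
      by (intro add_mono mult_left_mono) (auto simp: one_le_power simp del: power_Suc)
    also have "\<dots> = real (Suc k) * d * (1 + a) ^ Suc k" by (simp add: algebra_simps)
    finally show ?case .
  qed (use assms in simp)
  then have "e n \<le> real n * d * (1 + a) ^ n" by simp
  also have "(1 + a) ^ n \<le> exp a ^ n"
    using assms(2) exp_ge_add_one_self[of a] by (intro power_mono) auto
  also have "exp a ^ n = exp (real n * a)" by (rule exp_of_nat_mult[symmetric])
  finally show ?thesis using assms(3) by (simp add: mult_left_mono)
qed

text \<open>Uniqueness identifies the given flow with a component of the explicit one.\<close>

lemma exact_flow_linear:
  assumes "exact_flow (\<lambda>v. A *v v + B *v v) E" "0 \<le> t"
  shows "E t u = snd (exp_flow (error_field A B) t (0, u))"
proof (rule linear_ode_unique[OF matrix_vector_mul_bounded_linear[of "A + B"] _ _ _ assms(2)])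
  let ?z = "\<lambda>t. exp_flow (error_field A B) t (0, u)"
  show "((\<lambda>t. E t u) has_vector_derivative (A + B) *v E t u) (at t within {0..})" if "0 \<le> t" for t
    using assms(1) that by (simp add: exact_flow_def exact_solution_def matrix_vector_mult_add_rdistrib)
  show "((\<lambda>t. snd (?z t)) has_vector_derivative (A + B) *v snd (?z t)) (at t within {0..})" for t
    using bounded_linear.has_vector_derivative[OF bounded_linear_snd
        has_vector_derivative_exp_flow[OF bounded_linear_error_field, of A B "(0, u)" t "{0..}"]]
    by (simp add: error_field_def)
  show "E 0 u = snd (?z 0)"
    using assms(1) by (simp add: exact_flow_def exp_flow_zero[OF bounded_linear_error_field])
qed

text \<open>Here \<open>r1\<close>, \<open>r2\<close>, \<open>r3\<close> are the remainders of the
  step, of y and of w; prefixes \<open>m\<close> and \<open>c\<close> mean multiplication by M and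
  C. The forcing C y in the equation for w cancels the commutator term of the step, so no term of
  order h^2 survives.\<close>

lemma modified_flow_remainder:
  fixes h :: real and y w my mw mmy mmw cy cw r1 r2 r3 :: "real^'n"
  shows "(r1 + ((y - (h / 2) *\<^sub>R w) + h *\<^sub>R (my - (h / 2) *\<^sub>R mw)
        + (h\<^sup>2 / 2) *\<^sub>R ((mmy - (h / 2) *\<^sub>R mmw) - (cy - (h / 2) *\<^sub>R cw))))
      - ((r2 + (y + h *\<^sub>R my + (h\<^sup>2 / 2) *\<^sub>R mmy)) - (h / 2) *\<^sub>R (r3 + (w + h *\<^sub>R (mw + cy))))
    = r1 - r2 + (h / 2) *\<^sub>R r3 + (h ^ 3 / 4) *\<^sub>R (cw - mmw)"
proof -
  have "(r1 + ((y - (h / 2) * w) + h * (my - (h / 2) * mw)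
        + (h\<^sup>2 / 2) * ((mmy - (h / 2) * mmw) - (cy - (h / 2) * cw))))
      - ((r2 + (y + h * my + (h\<^sup>2 / 2) * mmy)) - (h / 2) * (r3 + (w + h * (mw + cy))))
    = r1 - r2 + (h / 2) * r3 + (h ^ 3 / 4) * (cw - mmw)"
    for y w my mw mmy mmw cy cw r1 r2 r3 :: real
    by (simp add: field_simps power2_eq_square power3_eq_cube)
  then show ?thesis
    unfolding vec_eq_iff
    by (simp only: vector_add_component vector_minus_component vector_scaleR_component real_scaleR_def simp_thms)
qed

lemma modified_flow_local_error:
  fixes A B :: "real^'n^'n"
  defines "z \<equiv> \<lambda>u t. exp_flow (error_field A B) t (0, u)"
  defines "v \<equiv> \<lambda>u t h. snd (z u t) - (h / 2) *\<^sub>R fst (z u t)"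
  assumes num: "numerical_map (\<lambda>v. A *v v) (\<lambda>v. B *v v) \<Phi>"
  obtains D where "D \<ge> 0" "\<forall>\<^sub>F h in at_right 0. \<forall>t. 0 \<le> t \<and> t + h \<le> T \<longrightarrow>
      norm (\<Phi> h (v u t h) - v u (t + h) h) \<le> D * h ^ 3"
proof -
  let ?M = "A + B" and ?C = "commutator A B" and ?N = "error_field A B"
  note N = bounded_linear_error_field[of A B]
  obtain b where b: "b \<ge> 0" "\<And>p. norm (?N p) \<le> b * norm p"
    using bounded_linear.nonneg_bounded[OF N] by (metis mult.commute)
  obtain K where K: "K \<ge> 0"
    "\<forall>\<^sub>F h in at_right 0. \<forall>u us un. imex_step (\<lambda>v. A *v v) (\<lambda>v. B *v v) h u us un \<longrightarrow>
      norm (un - (u + h *\<^sub>R (?M *v u) + (h\<^sup>2 / 2) *\<^sub>R (?M *v (?M *v u) - ?C *v u)))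
        \<le> K * h ^ 3 * norm u"
    by (rule imex_step_linear_estimate)
  have "bounded_linear (\<lambda>w. ?C *v w - ?M *v (?M *v w))"
    by (intro bounded_linear_sub bounded_linear_compose[OF matrix_vector_mul_bounded_linear]
        matrix_vector_mul_bounded_linear)
  then obtain Q where Q: "Q \<ge> 0" "\<And>w. norm (?C *v w - ?M *v (?M *v w)) \<le> norm w * Q"
    using bounded_linear.nonneg_bounded by blast
  have z': "(z u has_vector_derivative ?N (z u s)) (at s within S)" for s S
    unfolding z_def by (rule has_vector_derivative_exp_flow[OF N])
  have "continuous_on {0..T} (z u)"
    unfolding continuous_on_eq_continuous_within
    using z' by (blast intro: has_vector_derivative_continuous)
  then have "bounded (z u ` {0..T})"
    by (intro compact_imp_bounded compact_continuous_image) auto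
  then obtain R0 where R0: "\<And>s. s \<in> {0..T} \<Longrightarrow> norm (z u s) \<le> R0" unfolding bounded_iff by blast
  \<comment> \<open>If \<open>T\<close> is negative the interval is empty and \<open>R0\<close> may
    have any sign; the maximum keeps the bound nonnegative.\<close>
  define R where "R = max R0 0"
  have R: "\<And>s. s \<in> {0..T} \<Longrightarrow> norm (z u s) \<le> R" "0 \<le> R" using R0 by (auto simp: R_def le_max_iff_disj)
  \<comment> \<open>One summand for each of the step remainder, the Taylor remainders of y and w,
    and the leftover third-order term; \<open>2 * R\<close> bounds the corrected trajectory for h <
    1.\<close>
  define D where "D = K * (2 * R) + b ^ 3 * R + (1/2) * (b\<^sup>2 * R) + (1/4) * (R * Q)"
  have "\<forall>\<^sub>F h in at_right 0. \<forall>t. 0 \<le> t \<and> t + h \<le> T \<longrightarrow>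
      norm (\<Phi> h (v u t h) - v u (t + h) h) \<le> D * h ^ 3"
    using K(2) num[unfolded numerical_map_def] eventually_at_right_real[of 0 1, simplified]
  proof eventually_elim
    case (elim h)
    then have h: "0 < h" "h < 1" by auto
    show ?case
    proof (intro allI impI)
      fix t assume t: "0 \<le> t \<and> t + h \<le> T"
      let ?y = "snd (z u t)" and ?w = "fst (z u t)" and ?v = "v u t h"
      have zR: "norm (z u s) \<le> R" if "s \<in> {t..t + h}" for s using that t by (intro R) auto
      have proj: "norm (fst q) \<le> norm q" "norm (snd q) \<le> norm q" for q :: "(real^'n) \<times> (real^'n)"
        by (metis norm_fst_le prod.collapse) (metis norm_snd_le prod.collapse)
      have wR: "norm ?w \<le> R" and yR: "norm ?y \<le> R"
        using proj[of "z u t"] zR[of t] h by auto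
      have "norm ?v \<le> R + (h / 2) * R" unfolding v_def using h by (intro norm_mono wR yR) auto
      also have "\<dots> \<le> 2 * R" using h mult_right_mono[of h 2 R] R(2) by simp
      finally have vR: "norm ?v \<le> 2 * R" .
      define r1 where "r1 = \<Phi> h ?v - (?v + h *\<^sub>R (?M *v ?v) + (h\<^sup>2 / 2) *\<^sub>R (?M *v (?M *v ?v) - ?C *v ?v))"
      define r2 where "r2 = snd (z u (t + h)) - (?y + h *\<^sub>R (?M *v ?y) + (h\<^sup>2 / 2) *\<^sub>R (?M *v (?M *v ?y)))"
      define r3 where "r3 = fst (z u (t + h)) - (?w + h *\<^sub>R (?M *v ?w + ?C *v ?y))"
      define p where "p = ?C *v ?w - ?M *v (?M *v ?w)"
      have "norm r1 \<le> K * h ^ 3 * norm ?v" unfolding r1_def using elim by blast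
      also have "\<dots> \<le> K * h ^ 3 * (2 * R)" using vR K(1) h by (intro mult_left_mono) auto
      finally have r1: "norm r1 \<le> (K * (2 * R)) * h ^ 3" by (simp add: mult_ac)
      note expansion = linear_ode_expansion[OF N b(2,1), of h t "z u" R, OF less_imp_le[OF h(1)]
          z' zR]
      have "r2 = snd (z u (t + h) - (z u t + h *\<^sub>R ?N (z u t) + (h\<^sup>2 / 2) *\<^sub>R ?N (?N (z u t))))"
        by (simp add: r2_def error_field_def)
      then have r2: "norm r2 \<le> (b ^ 3 * R) * h ^ 3"
        by (simp only:) (rule order_trans[OF proj(2) expansion(2)])
      have "r3 = fst (z u (t + h) - (z u t + h *\<^sub>R ?N (z u t)))"
        by (simp add: r3_def error_field_def)
      then have r3: "norm r3 \<le> b\<^sup>2 * R * h\<^sup>2"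
        by (simp only:) (rule order_trans[OF proj(1) expansion(1)])
      have p: "norm p \<le> R * Q" unfolding p_def by (rule order_trans[OF Q(2) mult_right_mono[OF wR Q(1)]])
      have "\<Phi> h ?v - v u (t + h) h
        = (r1 + ((?y - (h / 2) *\<^sub>R ?w) + h *\<^sub>R (?M *v ?y - (h / 2) *\<^sub>R (?M *v ?w))
            + (h\<^sup>2 / 2) *\<^sub>R ((?M *v (?M *v ?y) - (h / 2) *\<^sub>R (?M *v (?M *v ?w)))
                - (?C *v ?y - (h / 2) *\<^sub>R (?C *v ?w)))))
          - ((r2 + (?y + h *\<^sub>R (?M *v ?y) + (h\<^sup>2 / 2) *\<^sub>R (?M *v (?M *v ?y))))
            - (h / 2) *\<^sub>R (r3 + (?w + h *\<^sub>R (?M *v ?w + ?C *v ?y))))"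
        unfolding r1_def r2_def r3_def unfolding v_def
        by (simp only: matrix_vector_mult_diff_distrib matrix_vector_mult_scaleR diff_add_cancel)
      also have "\<dots> = r1 - r2 + (h / 2) *\<^sub>R r3 + (h ^ 3 / 4) *\<^sub>R p"
        unfolding p_def by (rule modified_flow_remainder)
      finally have "norm (\<Phi> h ?v - v u (t + h) h) = norm (r1 - r2 + (h / 2) *\<^sub>R r3 + (h ^ 3 / 4) *\<^sub>R p)"
        by (rule arg_cong)
      also have "\<dots> \<le> (K * (2 * R)) * h ^ 3 + (b ^ 3 * R) * h ^ 3 + (h / 2) * (b\<^sup>2 * R * h\<^sup>2) + (h ^ 3 / 4) * (R * Q)"
        using h by (intro norm_mono r1 r2 r3 p) auto
      also have "\<dots> = D * h ^ 3"
        unfolding D_def by (simp add: algebra_simps power2_eq_square power3_eq_cube)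
      finally show "norm (\<Phi> h ?v - v u (t + h) h) \<le> D * h ^ 3" .
    qed
  qed
  moreover have "D \<ge> 0" unfolding D_def using K b R Q by simp
  ultimately show thesis using that by blast
qed

text \<open>The corrected trajectory has local defect O(h^3). Stability lets these defects
  accumulate over at most T/h steps, which leaves O(h^2), uniformly in the step number.\<close>

lemma global_error_expansion:
  fixes A B :: "real^'n^'n"
  assumes E: "exact_flow (\<lambda>v. A *v v + B *v v) E"
    and num: "numerical_map (\<lambda>v. A *v v) (\<lambda>v. B *v v) \<Phi>" and stable: "one_step_stable \<Phi>"
  obtains K where "K \<ge> 0" "\<forall>\<^sub>F h in at_right 0. \<forall>k. real k * h \<le> T \<longrightarrow>
    norm ((\<Phi> h ^^ k) u - E (real k * h) u + (h / 2) *\<^sub>R error_coefficient A B (real k * h) u) \<le> K * h\<^sup>2"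
proof -
  let ?z = "\<lambda>t. exp_flow (error_field A B) t (0, u)"
  let ?v = "\<lambda>t h. snd (?z t) - (h / 2) *\<^sub>R fst (?z t)"
  obtain D where D: "D \<ge> 0" "\<forall>\<^sub>F h in at_right 0. \<forall>t. 0 \<le> t \<and> t + h \<le> T \<longrightarrow>
      norm (\<Phi> h (?v t h) - ?v (t + h) h) \<le> D * h ^ 3"
    by (rule modified_flow_local_error[OF num])
  obtain L where L: "L \<ge> 0"
      "\<forall>\<^sub>F h in at_right 0. \<forall>u v. norm (\<Phi> h u - \<Phi> h v) \<le> (1 + L * h) * norm (u - v)"
    using stable unfolding one_step_stable_def by blast
  define K where "K = \<bar>T\<bar> * D * exp (L * \<bar>T\<bar>)"
  have "\<forall>\<^sub>F h in at_right 0. \<forall>k. real k * h \<le> T \<longrightarrow>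
    norm ((\<Phi> h ^^ k) u - E (real k * h) u + (h / 2) *\<^sub>R error_coefficient A B (real k * h) u) \<le> K * h\<^sup>2"
    using D(2) L(2) eventually_at_right_less[of 0]
  proof eventually_elim
    case (elim h)
    show ?case
    proof (intro allI impI)
      fix n assume n: "real n * h \<le> T"
      define e where "e k = norm ((\<Phi> h ^^ k) u - ?v (real k * h) h)" for k
      have "e n \<le> real n * (D * h ^ 3) * exp (real n * (L * h))"
      proof (rule discrete_gronwall)
        show "e 0 \<le> 0" by (simp add: e_def exp_flow_zero[OF bounded_linear_error_field])
        show "0 \<le> L * h" "0 \<le> D * h ^ 3" using L(1) D(1) elim(3) by auto
        fix k assume "k < n"
        let ?s = "real k * h"
        have sucs: "real (Suc k) * h = ?s + h" by (simp add: algebra_simps)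
        have "real (Suc k) * h \<le> real n * h" using \<open>k < n\<close> elim(3) by (intro mult_right_mono) auto
        with n have "?s + h \<le> T" unfolding sucs by linarith
        then have 1: "norm (\<Phi> h (?v ?s h) - ?v (?s + h) h) \<le> D * h ^ 3"
          using elim(1,3) by simp
        have 2: "norm (\<Phi> h ((\<Phi> h ^^ k) u) - \<Phi> h (?v ?s h)) \<le> (1 + L * h) * e k"
          unfolding e_def using elim(2) by blast
        have "e (Suc k) = norm ((\<Phi> h ((\<Phi> h ^^ k) u) - \<Phi> h (?v ?s h)) + (\<Phi> h (?v ?s h) - ?v (?s + h) h))"
          unfolding e_def sucs by (simp add: algebra_simps)
        also have "\<dots> \<le> (1 + L * h) * e k + D * h ^ 3" by (rule norm_triangle_mono[OF 2 1])
        finally show "e (Suc k) \<le> (1 + L * h) * e k + D * h ^ 3" .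
      qed
      also have "\<dots> = (real n * h) * D * exp (L * (real n * h)) * h\<^sup>2"
        by (simp add: power2_eq_square power3_eq_cube mult_ac)
      also have "\<dots> \<le> K * h\<^sup>2"
        unfolding K_def using n elim(3) L(1) D(1)
        by (intro mult_right_mono mult_mono) (auto intro!: mult_left_mono)
      finally have "e n \<le> K * h\<^sup>2" .
      moreover have "E (real n * h) u = snd (?z (real n * h))"
        using elim(3) by (intro exact_flow_linear[OF E]) simp
      ultimately show "norm ((\<Phi> h ^^ n) u - E (real n * h) u
          + (h / 2) *\<^sub>R error_coefficient A B (real n * h) u) \<le> K * h\<^sup>2"
        by (simp add: e_def error_coefficient_def algebra_simps)
    qed
  qed
  moreover have "K \<ge> 0" unfolding K_def using D by simp
  ultimately show thesis using that by blast
qed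

section \<open>First-order upper bound and its sharpness\<close>

lemma continuous_on_error_coefficient:
  "continuous_on S (\<lambda>p. error_coefficient A B (fst p) (snd p))"
proof -
  have "continuous_on S (\<lambda>p. (fst p, 0, snd p))" by (intro continuous_intros)
  from continuous_on_compose2[OF continuous_on_exp_flow[OF bounded_linear_error_field, of UNIV A B] this]
  show ?thesis unfolding error_coefficient_def by (auto intro: continuous_on_fst)
qed

text \<open>The leading coefficient is bounded on the compact time interval, and h^2 \<le> h for h <
  1.\<close>

lemma global_error_bound:
  fixes A B :: "real^'n^'n"
  assumes "exact_flow (\<lambda>v. A *v v + B *v v) E"
    and "numerical_map (\<lambda>v. A *v v) (\<lambda>v. B *v v) \<Phi>" and "one_step_stable \<Phi>"
  shows "\<exists>C. \<forall>\<^sub>F h in at_right 0. \<forall>k. real k * h \<le> T \<longrightarrow> global_error E \<Phi> h k u \<le> C * h"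
proof -
  obtain K where K: "K \<ge> 0" "\<forall>\<^sub>F h in at_right 0. \<forall>k. real k * h \<le> T \<longrightarrow>
    norm ((\<Phi> h ^^ k) u - E (real k * h) u + (h / 2) *\<^sub>R error_coefficient A B (real k * h) u) \<le> K * h\<^sup>2"
    by (rule global_error_expansion[OF assms])
  have "continuous_on {0..T} (\<lambda>t. error_coefficient A B t u)"
  proof -
    have "continuous_on {0..T} (\<lambda>t. (t, u))" by (intro continuous_intros)
    from continuous_on_compose2[OF continuous_on_error_coefficient this subset_UNIV] show ?thesis by simp
  qed
  then have "bounded ((\<lambda>t. error_coefficient A B t u) ` {0..T})"
    by (intro compact_imp_bounded compact_continuous_image) auto
  then obtain W where W: "\<And>s. s \<in> {0..T} \<Longrightarrow> norm (error_coefficient A B s u) \<le> W"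
    unfolding bounded_iff by blast
  have "\<forall>\<^sub>F h in at_right 0. \<forall>k. real k * h \<le> T \<longrightarrow> global_error E \<Phi> h k u \<le> (K + W / 2) * h"
    using K(2) eventually_at_right_real[of 0 1, simplified]
  proof eventually_elim
    case (elim h)
    then have h: "0 < h" "h < 1" by auto
    show ?case
    proof (intro allI impI)
      fix k assume k: "real k * h \<le> T"
      let ?c = "error_coefficient A B (real k * h) u"
      have 1: "norm ((\<Phi> h ^^ k) u - E (real k * h) u + (h / 2) *\<^sub>R ?c) \<le> K * h\<^sup>2"
        using elim k by blast
      have 2: "norm ((h / 2) *\<^sub>R ?c) \<le> (h / 2) * W" using h k by (intro norm_scaleR_mono W) auto
      have "global_error E \<Phi> h k u \<le> K * h\<^sup>2 + (h / 2) * W"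
        using norm_triangle_mono_diff[OF 1 2] by (simp add: global_error_def)
      also have "K * h\<^sup>2 \<le> K * h"
        using K(1) h by (intro mult_left_mono) (auto simp: power2_eq_square mult_left_le)
      finally show "global_error E \<Phi> h k u \<le> (K + W / 2) * h" by (simp add: algebra_simps)
    qed
  qed
  then show ?thesis by blast
qed

text \<open>With h = T/k the final time is exactly \<open>T\<close>, so the fixed vector
  \<open>error_coefficient A B T u\<close> governs the leading term and eventually dominates the
  O(h^2) remainder.\<close>

lemma global_error_sharp:
  fixes A B :: "real^'n^'n"
  assumes "exact_flow (\<lambda>v. A *v v + B *v v) E"
    and "numerical_map (\<lambda>v. A *v v) (\<lambda>v. B *v v) \<Phi>" and "one_step_stable \<Phi>"
    and "0 < T" and nz: "error_coefficient A B T u \<noteq> 0"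
  shows "(\<lambda>k. global_error E \<Phi> (T / real k) k u) \<in> \<Theta>[sequentially](\<lambda>k. T / real k)"
proof -
  let ?c = "error_coefficient A B T u"
  obtain K where K: "K \<ge> 0" "\<forall>\<^sub>F h in at_right 0. \<forall>k. real k * h \<le> T \<longrightarrow>
    norm ((\<Phi> h ^^ k) u - E (real k * h) u + (h / 2) *\<^sub>R error_coefficient A B (real k * h) u) \<le> K * h\<^sup>2"
    by (rule global_error_expansion[OF assms(1-3)])
  \<comment> \<open>Chosen so that K h^2 is at most half of the leading term (h/2) |c|;
    \<open>K + 1\<close> avoids division by zero.\<close>
  define \<eta> where "\<eta> = norm ?c / (4 * (K + 1))"
  have "0 < \<eta>" using nz K(1) by (simp add: \<eta>_def)
  have lim: "filterlim (\<lambda>k. T / real k) (at_right 0) sequentially"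
    using \<open>0 < T\<close> lim_const_over_n[of T]
    by (auto simp: filterlim_at intro: eventually_mono[OF eventually_gt_at_top[of 0]])
  have ev: "\<forall>\<^sub>F k in sequentially. k > 0 \<and> T / real k \<in> {0<..<\<eta>} \<and> norm ((\<Phi> (T / real k) ^^ k) u - E T u + (T / real k / 2) *\<^sub>R ?c) \<le> K * (T / real k)\<^sup>2"
    using eventually_compose_filterlim[OF K(2) lim] eventually_gt_at_top[of 0]
      eventually_compose_filterlim[OF eventually_at_right_real[OF \<open>0 < \<eta>\<close>] lim]
  proof eventually_elim
    case (elim k)
    then have "real k * (T / real k) = T" by simp
    with elim show ?case by (metis order_refl)
  qed
  have "\<forall>\<^sub>F k in sequentially. norm (global_error E \<Phi> (T / real k) k u) \<le> (K * \<eta> + norm ?c / 2) * norm (T / real k)"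
    using ev
  proof eventually_elim
    case (elim k)
    define h where "h = T / real k"
    have h: "0 < h" "h < \<eta>" and kh: "real k * h = T"
      and est: "norm ((\<Phi> h ^^ k) u - E T u + (h / 2) *\<^sub>R ?c) \<le> K * h\<^sup>2"
      using elim by (auto simp: h_def)
    have "norm ((h / 2) *\<^sub>R ?c) \<le> (h / 2) * norm ?c" using h by (intro norm_scaleR_mono) auto
    from norm_triangle_mono_diff[OF est this]
    have "global_error E \<Phi> h k u \<le> K * h\<^sup>2 + (h / 2) * norm ?c"
      unfolding global_error_def kh by simp
    also have "K * h\<^sup>2 \<le> K * (\<eta> * h)"
      using K(1) h unfolding power2_eq_square by (intro mult_left_mono mult_right_mono) auto
    finally show ?case using h unfolding h_def[symmetric] by (simp add: global_error_def algebra_simps)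
  qed
  then have upper: "(\<lambda>k. global_error E \<Phi> (T / real k) k u) \<in> O(\<lambda>k. T / real k)" by (rule bigoI)
  have "\<forall>\<^sub>F k in sequentially. norm (T / real k) \<le> (4 / norm ?c) * norm (global_error E \<Phi> (T / real k) k u)"
    using ev
  proof eventually_elim
    case (elim k)
    define h where "h = T / real k"
    have h: "0 < h" "h < \<eta>" and kh: "real k * h = T"
      and est: "norm ((\<Phi> h ^^ k) u - E T u + (h / 2) *\<^sub>R ?c) \<le> K * h\<^sup>2"
      using elim by (auto simp: h_def)
    have "(h / 2) * norm ?c = norm ((h / 2) *\<^sub>R ?c)" using h by simp
    also have "\<dots> \<le> K * h\<^sup>2 + global_error E \<Phi> h k u"
      using norm_triangle_mono_diff[OF est order_refl[of "norm ((\<Phi> h ^^ k) u - E T u)"]]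
      unfolding global_error_def kh by simp
    also have "K * h\<^sup>2 \<le> (h / 4) * norm ?c"
    proof -
      have "K * h \<le> (K + 1) * \<eta>" using K(1) h by (intro mult_mono) auto
      also have "\<dots> = norm ?c / 4" using K(1) by (simp add: \<eta>_def field_simps)
      finally have "h * (K * h) \<le> h * (norm ?c / 4)" using h by (intro mult_left_mono) auto
      then show ?thesis by (simp add: power2_eq_square mult_ac)
    qed
    finally have "(h / 4) * norm ?c \<le> global_error E \<Phi> h k u" by simp
    then show ?case using nz h unfolding h_def[symmetric] by (simp add: global_error_def field_simps)
  qed
  then have "(\<lambda>k. T / real k) \<in> O(\<lambda>k. global_error E \<Phi> (T / real k) k u)" by (rule bigoI)
  with upper show ?thesis by (simp add: bigtheta_def bigomega_iff_bigo)
qed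

section \<open>The exceptional set of final times and initial values\<close>

lemma closed_error_coefficient_zeros: "closed {p. error_coefficient A B (fst p) (snd p) = 0}"
proof -
  have "closed {p \<in> UNIV. error_coefficient A B (fst p) (snd p) = 0}"
    by (intro continuous_closed_preimage_constant continuous_on_error_coefficient closed_UNIV)
  then show ?thesis by simp
qed

text \<open>Fubini with time as the inner variable: for \<open>u\<close> outside the null kernel of
  the commutator, analyticity makes the set of exceptional times countable.\<close>

lemma negligible_error_coefficient_zeros:
  fixes A B :: "real^'n^'n"
  assumes "commutator A B \<noteq> 0"
  shows "negligible {p. error_coefficient A B (fst p) (snd p) = 0}" (is "negligible ?Z")
proof -
  have Z: "?Z \<in> sets (lborel :: (real \<times> (real^'n)) measure)"
    by (auto intro: borel_closed closed_error_coefficient_zeros)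
  have countable: "countable {t. error_coefficient A B t u = 0}" if nz: "commutator A B *v u \<noteq> 0" for u
  proof -
    obtain i :: 'n where "(commutator A B *v u) $ i \<noteq> 0" using nz by (auto simp: vec_eq_iff)
    then have "error_field A B (0, u) \<bullet> (axis i 1, 0) \<noteq> 0"
      by (simp add: error_field_def inner_axis)
    then have "countable {t. exp_flow (error_field A B) t (0, u) \<bullet> (axis i 1, 0) = 0}"
      by (rule countable_exp_flow_zeros[OF bounded_linear_error_field])
    then show ?thesis
      by (rule countable_subset[rotated]) (auto simp: error_coefficient_def inner_prod_def)
  qed
  \<comment> \<open>A nonzero row of the commutator places its kernel in a hyperplane.\<close>
  obtain i where i: "commutator A B $ i \<noteq> 0"
    using assms by (metis vec_eq_iff zero_index)
  have "{u. commutator A B *v u = 0} \<subseteq> {u. commutator A B $ i \<bullet> u = 0}"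
    by (auto simp flip: matrix_vector_mul_component)
  then have "negligible {u. commutator A B *v u = 0}"
    using negligible_hyperplane[of "commutator A B $ i" 0] i by (auto intro: negligible_subset)
  then have "AE u in lebesgue. commutator A B *v u \<noteq> 0"
    by (auto simp: negligible_iff_null_sets intro: AE_not_in[THEN AE_mp])
  then have "AE u in lborel. commutator A B *v u \<noteq> 0"
    by (simp add: AE_completion_iff)
  then have "AE u in lborel. emeasure lborel ((\<lambda>t. (t, u)) -` ?Z) = 0"
    by (rule AE_mp) (auto intro!: AE_I2 emeasure_lborel_countable countable)
  then have "(\<integral>\<^sup>+u. emeasure lborel ((\<lambda>t. (t, u)) -` ?Z) \<partial>lborel) = (\<integral>\<^sup>+u. 0 \<partial>(lborel :: (real^'n) measure))"
    by (rule nn_integral_cong_AE)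
  then have "emeasure (lborel \<Otimes>\<^sub>M lborel) ?Z = 0"
    unfolding lborel_pair.emeasure_pair_measure_alt2[OF Z[folded lborel_prod]] by simp
  then have "?Z \<in> null_sets lborel" using Z by (simp add: lborel_prod null_setsI)
  then show ?thesis by (simp add: negligible_iff_null_sets null_sets_completionI)
qed

text \<open>As the method is implicit, the first two claims concern any family of values satisfying
  its equations. "Generically" is made precise as: outside a closed null set of pairs of final time
  and initial value. There \<Theta> excludes any order higher than one.\<close>

theorem proposition4p1:
  shows
    "(\<forall>(F :: real^'n \<Rightarrow> real^'n) G H S K u Ustar Unew.
        open S \<and> C2_on F S \<and> C2_on G S \<and> H = (\<lambda>v. F v + G v) \<and> u \<in> S \<and>
        compact K \<and> K \<subseteq> S \<and>
        (\<forall>\<^sub>F h in at_right 0. Ustar h \<in> K \<and> Unew h \<in> K \<and> imex_step F G h u (Ustar h) (Unew h))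
        \<longrightarrow> (\<lambda>h. norm (Unew h -
               (u + h *\<^sub>R H u + (h\<^sup>2 / 2) *\<^sub>R (jacobian H (at u) *v H u)
                  + (h\<^sup>2 / 2) *\<^sub>R (jacobian G (at u) *v F u - jacobian F (at u) *v G u))))
            \<in> O[at_right 0](\<lambda>h. h ^ 3))
     \<and>
     (\<forall>(A :: real^'n^'n) B U tn \<delta> Ustar Unew.
        \<delta> > 0 \<and> exact_solution (\<lambda>v. A *v v + B *v v) {tn..tn + \<delta>} U \<and>
        (\<forall>\<^sub>F h in at_right 0. imex_step (\<lambda>v. A *v v) (\<lambda>v. B *v v) h (U tn) (Ustar h) (Unew h))
        \<longrightarrow> (\<lambda>h. norm ((Unew h - U (tn + h)) - (- (h\<^sup>2 / 2)) *\<^sub>R (commutator A B *v U tn)))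
            \<in> O[at_right 0](\<lambda>h. h ^ 3))
     \<and>
     (\<forall>(A :: real^'n^'n) B E \<Phi>.
        commutator A B \<noteq> 0 \<and>
        exact_flow (\<lambda>v. A *v v + B *v v) E \<and>
        numerical_map (\<lambda>v. A *v v) (\<lambda>v. B *v v) \<Phi> \<and>
        one_step_stable \<Phi>
        \<longrightarrow> (\<forall>u T. \<exists>C. \<forall>\<^sub>F h in at_right 0. \<forall>k. real k * h \<le> T \<longrightarrow> global_error E \<Phi> h k u \<le> C * h)
          \<and> (\<exists>Z :: (real \<times> (real^'n)) set. closed Z \<and> negligible Z \<and>
               (\<forall>T>0. \<forall>u. (T, u) \<notin> Z \<longrightarrow>
                  (\<lambda>k. global_error E \<Phi> (T / real k) k u) \<in> \<Theta>[sequentially](\<lambda>k. T / real k))))"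
proof (intro conjI allI impI; (elim conjE)?)
  fix F G H :: "real^'n \<Rightarrow> real^'n" and S K u Ustar Unew
  assume "open S" "C2_on F S" "C2_on G S" and H: "H = (\<lambda>v. F v + G v)" and "u \<in> S" "compact K" "K \<subseteq> S"
    and "\<forall>\<^sub>F h in at_right 0. Ustar h \<in> K \<and> Unew h \<in> K \<and> imex_step F G h u (Ustar h) (Unew h)"
  then show "(\<lambda>h. norm (Unew h -
               (u + h *\<^sub>R H u + (h\<^sup>2 / 2) *\<^sub>R (jacobian H (at u) *v H u)
                  + (h\<^sup>2 / 2) *\<^sub>R (jacobian G (at u) *v F u - jacobian F (at u) *v G u))))
            \<in> O[at_right 0](\<lambda>h. h ^ 3)"
    unfolding H by (intro order_at_0_imp_bigo imex_step_expansion)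
next
  fix A B :: "real^'n^'n" and U tn \<delta> Ustar Unew
  assume "\<delta> > 0" "exact_solution (\<lambda>v. A *v v + B *v v) {tn..tn + \<delta>} U"
    "\<forall>\<^sub>F h in at_right 0. imex_step (\<lambda>v. A *v v) (\<lambda>v. B *v v) h (U tn) (Ustar h) (Unew h)"
  then show "(\<lambda>h. norm ((Unew h - U (tn + h)) - (- (h\<^sup>2 / 2)) *\<^sub>R (commutator A B *v U tn)))
            \<in> O[at_right 0](\<lambda>h. h ^ 3)"
    by (intro order_at_0_imp_bigo imex_linear_local_error)
next
  fix A B :: "real^'n^'n" and E \<Phi> u T
  assume "exact_flow (\<lambda>v. A *v v + B *v v) E"
    "numerical_map (\<lambda>v. A *v v) (\<lambda>v. B *v v) \<Phi>" "one_step_stable \<Phi>"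
  then show "\<exists>C. \<forall>\<^sub>F h in at_right 0. \<forall>k. real k * h \<le> T \<longrightarrow> global_error E \<Phi> h k u \<le> C * h"
    by (rule global_error_bound)
next
  fix A B :: "real^'n^'n" and E \<Phi>
  assume nz: "commutator A B \<noteq> 0"
    and hyps: "exact_flow (\<lambda>v. A *v v + B *v v) E"
      "numerical_map (\<lambda>v. A *v v) (\<lambda>v. B *v v) \<Phi>" "one_step_stable \<Phi>"
  show "\<exists>Z :: (real \<times> (real^'n)) set. closed Z \<and> negligible Z \<and>
               (\<forall>T>0. \<forall>u. (T, u) \<notin> Z \<longrightarrow>
                  (\<lambda>k. global_error E \<Phi> (T / real k) k u) \<in> \<Theta>[sequentially](\<lambda>k. T / real k))"
    using closed_error_coefficient_zeros negligible_error_coefficient_zeros[OF nz]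
    by (intro exI[of _ "{p. error_coefficient A B (fst p) (snd p) = 0}"] conjI allI impI
        global_error_sharp[OF hyps]) auto
qed

end
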